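(* Let $T$ be a complete theory in a language $L$, with monster model $\mathbb{M}$ (universe $M$), and let $n,d\in\omega$. The following are equivalent: (1) $T$ interprets some infinite $d$-maximum VC family in $n$ parameters; (2) $T$ interprets $[\omega]^d=\{A\subseteq\omega:|A|=d\}$ in $n$ parameters; (3) $\mathrm{dpR}(n)\geq d$, i.e. there is an ICT pattern of depth $d$ in a tuple of $n$ distinct variables.
   Context: For a set $X$ and $\mathcal{C}\subseteq 2^X$ and $A\subseteq X$, let $\mathcal{C}(A)=\{c\cap A:c\in\mathcal{C}\}$; $\mathcal{C}$ shatters $A$ if $\mathcal{C}(A)=2^A$; the VC dimension of $\mathcal{C}$ is the supremum of the sizes of shattered sets. For $d,m\in\omega$ let $\Phi_d(m)=\sum_{i=0}^d\binom{m}{i}$ if $m\geq d$ and $2^m$ otherwise. $\mathcal{C}$ is $d$-maximum if its VC dimension is $d$ and $|\mathcal{C}(A)|=\Phi_d(|A|)$ for every finite $A\subseteq X$. $T$ interprets $\mathcal{C}\subseteq 2^X$ in $n$ parameters if there are an $L$-formula $\varphi(\bar x;\bar y)$ with $\bar y=(y_1,\dots,y_n)$ and an injection $f:X\to M^{|\bar x|}$ such that for every $c\in\mathcal{C}$ there is $\bar b_c\in M^n$ with $f(c)=\{\bar a\in f(X):\mathbb{M}\models\varphi(\bar a;\bar b_c)\}$ (other parameters $\bar b$ may define sets not of the form $f(c)$). For a cardinal $\kappa$, an ICT pattern of depth $\kappa$ in variables $\bar x$ is a family of formulas $\{\psi_\alpha(\bar x;\bar y_\alpha):\alpha<\kappa\}$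 together with tuples $\bar b^\alpha_m$ ($\alpha<\kappa$, $m<\omega$) in $\mathbb{M}$ with $\mathrm{lg}(\bar b^\alpha_m)=\mathrm{lg}(\bar y_\alpha)$, such that for every $\eta:\kappa\to\omega$ the set $\{\psi_\alpha(\bar x;\bar b^\alpha_{\eta(\alpha)}):\alpha<\kappa\}\cup\{\neg\psi_\alpha(\bar x;\bar b^\alpha_m):\alpha<\kappa,m<\omega,m\neq\eta(\alpha)\}$ is consistent. $\mathrm{dpR}(n)$ is the maximum depth of an ICT pattern in a tuple $\bar x$ of $n$ distinct variables. *)

theory Defs
  imports Main "HOL-Library.Extended_Nat" "HOL-Library.Ramsey"
begin

unbundle cardinal_syntax

text \<open>A language is given by sets of symbols rather than by whole types, so that it may have no
  function symbols or no relation symbols. Constants are function symbols of arity 0.\<close>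

record ('f, 'r) language =
  Funs :: "'f set"
  Rels :: "'r set"
  fun_arity :: "'f \<Rightarrow> nat"
  rel_arity :: "'r \<Rightarrow> nat"

datatype 'f fo_term = Var nat | Fun 'f "'f fo_term list"

datatype ('f, 'r) formula =
    Equal "'f fo_term" "'f fo_term"
  | Rel 'r "'f fo_term list"
  | Neg "('f, 'r) formula"
  | Conj "('f, 'r) formula" "('f, 'r) formula"
  | Exists nat "('f, 'r) formula"

primrec vars_term :: "'f fo_term \<Rightarrow> nat set" where
  "vars_term (Var i) = {i}"
| "vars_term (Fun f ts) = \<Union> (set (map vars_term ts))"

primrec free_vars :: "('f, 'r) formula \<Rightarrow> nat set" where
  "free_vars (Equal s t) = vars_term s \<union> vars_term t"
| "free_vars (Rel r ts) = \<Union> (set (map vars_term ts))"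
| "free_vars (Neg \<phi>) = free_vars \<phi>"
| "free_vars (Conj \<phi> \<psi>) = free_vars \<phi> \<union> free_vars \<psi>"
| "free_vars (Exists i \<phi>) = free_vars \<phi> - {i}"

primrec wf_term :: "('f, 'r) language \<Rightarrow> 'f fo_term \<Rightarrow> bool" where
  "wf_term L (Var i) \<longleftrightarrow> True"
| "wf_term L (Fun f ts) \<longleftrightarrow>
     f \<in> Funs L \<and> length ts = fun_arity L f \<and> list_all (wf_term L) ts"

primrec wf_formula :: "('f, 'r) language \<Rightarrow> ('f, 'r) formula \<Rightarrow> bool" where
  "wf_formula L (Equal s t) \<longleftrightarrow> wf_term L s \<and> wf_term L t"
| "wf_formula L (Rel r ts) \<longleftrightarrow>
     r \<in> Rels L \<and> length ts = rel_arity L r \<and> list_all (wf_term L) ts"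
| "wf_formula L (Neg \<phi>) \<longleftrightarrow> wf_formula L \<phi>"
| "wf_formula L (Conj \<phi> \<psi>) \<longleftrightarrow> wf_formula L \<phi> \<and> wf_formula L \<psi>"
| "wf_formula L (Exists i \<phi>) \<longleftrightarrow> wf_formula L \<phi>"

text \<open>The \<open>L\<close>-formulas whose free variables are among the variables \<open>0, \<dots>, k - 1\<close>. A partitioned
  formula \<open>\<phi>(x; y)\<close> with \<open>x\<close> of length \<open>k\<close> and \<open>y\<close> of length \<open>n\<close> is an element of
  \<open>formulas L (k + n)\<close>, the variables \<open>0, \<dots>, k - 1\<close> being \<open>x\<close> and \<open>k, \<dots>, k + n - 1\<close> being \<open>y\<close>.\<close>

definition formulas :: "('f, 'r) language \<Rightarrow> nat \<Rightarrow> ('f, 'r) formula set" where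
  "formulas L k = {\<phi>. wf_formula L \<phi> \<and> free_vars \<phi> \<subseteq> {..<k}}"

abbreviation sentences :: "('f, 'r) language \<Rightarrow> ('f, 'r) formula set" where
  "sentences L \<equiv> formulas L 0"

record ('f, 'r, 'm) struct =
  univ :: "'m set"
  fun_interp :: "'f \<Rightarrow> 'm list \<Rightarrow> 'm"
  rel_interp :: "'r \<Rightarrow> 'm list \<Rightarrow> bool"

definition tuples :: "'a set \<Rightarrow> nat \<Rightarrow> 'a list set" where
  "tuples A k = {as. set as \<subseteq> A \<and> length as = k}"

definition is_structure :: "('f, 'r) language \<Rightarrow> ('f, 'r, 'm) struct \<Rightarrow> bool" where
  "is_structure L M \<longleftrightarrow>
     univ M \<noteq> {} \<and>
     (\<forall>f\<in>Funs L. \<forall>as\<in>tuples (univ M) (fun_arity L f). fun_interp M f as \<in> univ M)"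

primrec eval_term :: "('f, 'r, 'm) struct \<Rightarrow> (nat \<Rightarrow> 'm) \<Rightarrow> 'f fo_term \<Rightarrow> 'm" where
  "eval_term M s (Var i) = s i"
| "eval_term M s (Fun f ts) = fun_interp M f (map (eval_term M s) ts)"

primrec sat :: "('f, 'r, 'm) struct \<Rightarrow> (nat \<Rightarrow> 'm) \<Rightarrow> ('f, 'r) formula \<Rightarrow> bool" where
  "sat M s (Equal t u) \<longleftrightarrow> eval_term M s t = eval_term M s u"
| "sat M s (Rel r ts) \<longleftrightarrow> rel_interp M r (map (eval_term M s) ts)"
| "sat M s (Neg \<phi>) \<longleftrightarrow> \<not> sat M s \<phi>"
| "sat M s (Conj \<phi> \<psi>) \<longleftrightarrow> sat M s \<phi> \<and> sat M s \<psi>"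
| "sat M s (Exists i \<phi>) \<longleftrightarrow> (\<exists>a\<in>univ M. sat M (s(i := a)) \<phi>)"

text \<open>\<open>M \<Turnstile> \<phi>(as)\<close> for \<open>\<phi> \<in> formulas L (length as)\<close>. The value of \<open>as ! i\<close> for \<open>i \<ge> length as\<close> is
  then irrelevant.\<close>

definition holds :: "('f, 'r, 'm) struct \<Rightarrow> ('f, 'r) formula \<Rightarrow> 'm list \<Rightarrow> bool" where
  "holds M \<phi> as \<longleftrightarrow> sat M (\<lambda>i. as ! i) \<phi>"

definition is_model ::
  "('f, 'r) language \<Rightarrow> ('f, 'r) formula set \<Rightarrow> ('f, 'r, 'm) struct \<Rightarrow> bool" where
  "is_model L T M \<longleftrightarrow> is_structure L M \<and> (\<forall>\<sigma>\<in>T. holds M \<sigma> [])"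

text \<open>HOL cannot quantify over all structures of arbitrary type, so semantic consequence refers to
  structures with universe contained in the type \<open>'m\<close>. By the downward Loewenheim--Skolem theorem
  this is the usual notion as soon as \<open>'m\<close> has at least \<open>|L| + \<aleph>\<^sub>0\<close> elements, which is the case
  when \<open>'m\<close> is the type of the elements of a monster model.\<close>

definition entails ::
  "'m itself \<Rightarrow> ('f, 'r) language \<Rightarrow> ('f, 'r) formula set \<Rightarrow> ('f, 'r) formula \<Rightarrow> bool" where
  "entails _ L T \<sigma> \<longleftrightarrow> (\<forall>N :: ('f, 'r, 'm) struct. is_model L T N \<longrightarrow> holds N \<sigma> [])"

definition complete_theory ::
  "'m itself \<Rightarrow> ('f, 'r) language \<Rightarrow> ('f, 'r) formula set \<Rightarrow> bool" where
  "complete_theory ty L T \<longleftrightarrow>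
     T \<subseteq> sentences L \<and>
     (\<exists>N :: ('f, 'r, 'm) struct. is_model L T N) \<and>
     (\<forall>\<sigma>\<in>sentences L. entails ty L T \<sigma> \<or> entails ty L T (Neg \<sigma>))"

text \<open>A pair \<open>(\<phi>, bs)\<close> with \<open>\<phi> \<in> formulas L (n + length bs)\<close> and \<open>bs\<close> a tuple of elements of \<open>A\<close>
  stands for the \<open>L(A)\<close>-formula \<open>\<phi>(x; bs)\<close> in the tuple \<open>x\<close> of the variables \<open>0, \<dots>, n - 1\<close>.\<close>

definition param_formulas ::
  "('f, 'r) language \<Rightarrow> 'm set \<Rightarrow> nat \<Rightarrow> (('f, 'r) formula \<times> 'm list) set" where
  "param_formulas L A n = {(\<phi>, bs). \<phi> \<in> formulas L (n + length bs) \<and> set bs \<subseteq> A}"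

definition realizes ::
  "('f, 'r, 'm) struct \<Rightarrow> 'm list \<Rightarrow> (('f, 'r) formula \<times> 'm list) set \<Rightarrow> bool" where
  "realizes M as \<Gamma> \<longleftrightarrow> (\<forall>(\<phi>, bs)\<in>\<Gamma>. holds M \<phi> (as @ bs))"

text \<open>A set of formulas with parameters in \<open>M\<close> is consistent (with the elementary diagram of \<open>M\<close>) iff
  it is finitely satisfiable in \<open>M\<close>.\<close>

definition consistent ::
  "('f, 'r, 'm) struct \<Rightarrow> nat \<Rightarrow> (('f, 'r) formula \<times> 'm list) set \<Rightarrow> bool" where
  "consistent M n \<Gamma> \<longleftrightarrow>
     (\<forall>\<Delta>. finite \<Delta> \<and> \<Delta> \<subseteq> \<Gamma> \<longrightarrow> (\<exists>as\<in>tuples (univ M) n. realizes M as \<Delta>))"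

definition saturated ::
  "('f, 'r) language \<Rightarrow> 'k rel \<Rightarrow> ('f, 'r, 'm) struct \<Rightarrow> bool" where
  "saturated L \<kappa> M \<longleftrightarrow>
     (\<forall>A \<Gamma>. A \<subseteq> univ M \<and> |A| <o \<kappa> \<and> \<Gamma> \<subseteq> param_formulas L A 1 \<and> consistent M 1 \<Gamma> \<longrightarrow>
       (\<exists>a\<in>univ M. realizes M [a] \<Gamma>))"

definition elementary_map ::
  "('f, 'r) language \<Rightarrow> ('f, 'r, 'm) struct \<Rightarrow> 'm set \<Rightarrow> ('m \<Rightarrow> 'm) \<Rightarrow> bool" where
  "elementary_map L M A h \<longleftrightarrow>
     A \<subseteq> univ M \<and> h ` A \<subseteq> univ M \<and>
     (\<forall>k. \<forall>\<phi>\<in>formulas L k. \<forall>as\<in>tuples A k. holds M \<phi> as \<longleftrightarrow> holds M \<phi> (map h as))"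

definition automorphism ::
  "('f, 'r) language \<Rightarrow> ('f, 'r, 'm) struct \<Rightarrow> ('m \<Rightarrow> 'm) \<Rightarrow> bool" where
  "automorphism L M g \<longleftrightarrow>
     bij_betw g (univ M) (univ M) \<and>
     (\<forall>f\<in>Funs L. \<forall>as\<in>tuples (univ M) (fun_arity L f).
        g (fun_interp M f as) = fun_interp M f (map g as)) \<and>
     (\<forall>r\<in>Rels L. \<forall>as\<in>tuples (univ M) (rel_arity L r).
        rel_interp M r as \<longleftrightarrow> rel_interp M r (map g as))"

definition strongly_homogeneous ::
  "('f, 'r) language \<Rightarrow> 'k rel \<Rightarrow> ('f, 'r, 'm) struct \<Rightarrow> bool" where
  "strongly_homogeneous L \<kappa> M \<longleftrightarrow>
     (\<forall>A h. |A| <o \<kappa> \<and> elementary_map L M A h \<longrightarrow>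
       (\<exists>g. automorphism L M g \<and> (\<forall>a\<in>A. g a = h a)))"

text \<open>The usual convention: a monster model is an infinite model which is \<open>\<kappa>\<close>-saturated and strongly
  \<open>\<kappa>\<close>-homogeneous for some large cardinal number \<open>\<kappa>\<close>; here "large" is taken in its weakest sense,
  \<open>\<kappa> > |L| + \<aleph>\<^sub>0\<close>.\<close>

definition monster_model ::
  "('f, 'r) language \<Rightarrow> ('f, 'r) formula set \<Rightarrow> 'k rel \<Rightarrow> ('f, 'r, 'm) struct \<Rightarrow> bool" where
  "monster_model L T \<kappa> M \<longleftrightarrow>
     Card_order \<kappa> \<and> natLeq <o \<kappa> \<and> |Funs L <+> Rels L| <o \<kappa> \<and>
     is_model L T M \<and> infinite (univ M) \<and> saturated L \<kappa> M \<and> strongly_homogeneous L \<kappa> M"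

definition trace :: "'x set set \<Rightarrow> 'x set \<Rightarrow> 'x set set" where
  "trace \<C> A = {c \<inter> A | c. c \<in> \<C>}"

definition shatters :: "'x set set \<Rightarrow> 'x set \<Rightarrow> bool" where
  "shatters \<C> A \<longleftrightarrow> trace \<C> A = Pow A"

definition vc_dim :: "'x set \<Rightarrow> 'x set set \<Rightarrow> enat" where
  "vc_dim X \<C> =
     Sup {if finite A then enat (card A) else \<infinity> | A. A \<subseteq> X \<and> shatters \<C> A}"

definition Phi :: "nat \<Rightarrow> nat \<Rightarrow> nat" where
  "Phi d m = (if m \<ge> d then \<Sum>i=0..d. m choose i else 2 ^ m)"

definition d_maximum :: "nat \<Rightarrow> 'x set \<Rightarrow> 'x set set \<Rightarrow> bool" where
  "d_maximum d X \<C> \<longleftrightarrow>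
     \<C> \<subseteq> Pow X \<and> vc_dim X \<C> = enat d \<and>
     (\<forall>A. A \<subseteq> X \<and> finite A \<longrightarrow> card (trace \<C> A) = Phi d (card A))"

definition interprets ::
  "('f, 'r) language \<Rightarrow> ('f, 'r, 'm) struct \<Rightarrow> nat \<Rightarrow> 'x set \<Rightarrow> 'x set set \<Rightarrow> bool" where
  "interprets L M n X \<C> \<longleftrightarrow>
     (\<exists>k. \<exists>\<phi>\<in>formulas L (k + n). \<exists>f. inj_on f X \<and> f ` X \<subseteq> tuples (univ M) k \<and>
       (\<forall>c\<in>\<C>. \<exists>bs\<in>tuples (univ M) n. f ` c = {as \<in> f ` X. holds M \<phi> (as @ bs)}))"

text \<open>"Infinite" refers to the underlying set \<open>X\<close>: for \<open>d \<ge> 1\<close> a \<open>d\<close>-maximum family on \<open>X\<close> is infinite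
  iff \<open>X\<close> is, whereas a 0-maximum family always is a singleton. It is no restriction that \<open>X\<close> is a set
  of tuples of elements of \<open>M\<close>, see \<open>interprets_infinite_maximumI\<close> below.\<close>

definition interprets_infinite_maximum ::
  "('f, 'r) language \<Rightarrow> ('f, 'r, 'm) struct \<Rightarrow> nat \<Rightarrow> nat \<Rightarrow> bool" where
  "interprets_infinite_maximum L M n d \<longleftrightarrow>
     (\<exists>(X :: 'm list set) \<C>. infinite X \<and> d_maximum d X \<C> \<and> interprets L M n X \<C>)"

text \<open>The depth of the pattern is the cardinality of the index set \<open>K\<close>; \<open>l \<alpha>\<close> is the length of the
  tuple of parameter variables of \<open>\<psi> \<alpha>\<close>.\<close>

definition ict_pattern ::
  "('f, 'r) language \<Rightarrow> ('f, 'r, 'm) struct \<Rightarrow> nat \<Rightarrow> 'a set \<Rightarrow>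
   ('a \<Rightarrow> nat) \<Rightarrow> ('a \<Rightarrow> ('f, 'r) formula) \<Rightarrow> ('a \<Rightarrow> nat \<Rightarrow> 'm list) \<Rightarrow> bool" where
  "ict_pattern L M n K l \<psi> b \<longleftrightarrow>
     (\<forall>\<alpha>\<in>K. \<psi> \<alpha> \<in> formulas L (n + l \<alpha>) \<and> (\<forall>m. b \<alpha> m \<in> tuples (univ M) (l \<alpha>))) \<and>
     (\<forall>\<eta> :: 'a \<Rightarrow> nat. consistent M n
        ({(\<psi> \<alpha>, b \<alpha> (\<eta> \<alpha>)) | \<alpha>. \<alpha> \<in> K} \<union>
         {(Neg (\<psi> \<alpha>), b \<alpha> m) | \<alpha> m. \<alpha> \<in> K \<and> m \<noteq> \<eta> \<alpha>}))"

definition dpR_ge :: "('f, 'r) language \<Rightarrow> ('f, 'r, 'm) struct \<Rightarrow> nat \<Rightarrow> nat \<Rightarrow> bool" where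
  "dpR_ge L M n d \<longleftrightarrow> (\<exists>l \<psi> b. ict_pattern L M n {..<d} l \<psi> b)"

lemma trace_image:
  assumes "inj_on f X" "\<C> \<subseteq> Pow X" "A \<subseteq> X"
  shows "trace ((`) f ` \<C>) (f ` A) = (`) f ` trace \<C> A"
proof -
  have "f ` c \<inter> f ` A = f ` (c \<inter> A)" if "c \<in> \<C>" for c
    using inj_on_image_Int[OF assms(1)] assms(2,3) that by blast
  then show ?thesis
    by (simp add: trace_def Setcompr_eq_image image_image)
qed

lemma inj_on_image_trace:
  assumes "inj_on f X" "A \<subseteq> X"
  shows "inj_on ((`) f) (trace \<C> A)"
proof (rule inj_on_subset)
  show "inj_on ((`) f) (Pow X)" using assms(1) by (rule inj_on_image_Pow)
  show "trace \<C> A \<subseteq> Pow X" using assms(2) by (auto simp: trace_def)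
qed

lemma shatters_image:
  assumes "inj_on f X" "\<C> \<subseteq> Pow X" "A \<subseteq> X"
  shows "shatters ((`) f ` \<C>) (f ` A) \<longleftrightarrow> shatters \<C> A"
proof -
  have "Pow (f ` A) = (`) f ` Pow A" by (simp add: image_Pow_surj)
  moreover have "trace \<C> A \<subseteq> Pow X" "Pow A \<subseteq> Pow X"
    using assms by (auto simp: trace_def)
  ultimately show ?thesis
    unfolding shatters_def trace_image[OF assms]
    by (simp add: inj_on_image_eq_iff[OF inj_on_image_Pow[OF assms(1)]])
qed

lemma d_maximum_image:
  assumes f: "inj_on f X" and max: "d_maximum d X \<C>"
  shows "d_maximum d (f ` X) ((`) f ` \<C>)"
proof -
  have sub: "\<C> \<subseteq> Pow X" using max by (simp add: d_maximum_def)
  have size: "finite (f ` A) \<longleftrightarrow> finite A" "card (f ` A) = card A" if "A \<subseteq> X" for A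
    using inj_on_subset[OF f that] by (simp_all add: finite_image_iff card_image)
  have "{if finite B then enat (card B) else \<infinity> | B. B \<subseteq> f ` X \<and> shatters ((`) f ` \<C>) B} =
        {if finite A then enat (card A) else \<infinity> | A. A \<subseteq> X \<and> shatters \<C> A}" (is "?l = ?r")
  proof (intro equalityI subsetI)
    fix s assume "s \<in> ?l"
    then obtain A where "A \<subseteq> X" "shatters ((`) f ` \<C>) (f ` A)"
      "s = (if finite (f ` A) then enat (card (f ` A)) else \<infinity>)"
      by (auto simp: subset_image_iff)
    then show "s \<in> ?r" using shatters_image[OF f sub] size by auto
  next
    fix s assume "s \<in> ?r"
    then obtain A where A: "A \<subseteq> X" "shatters \<C> A"
      "s = (if finite A then enat (card A) else \<infinity>)" by auto
    then have "s = (if finite (f ` A) then enat (card (f ` A)) else \<infinity>)"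
      "f ` A \<subseteq> f ` X" "shatters ((`) f ` \<C>) (f ` A)"
      using shatters_image[OF f sub] size by auto
    then show "s \<in> ?l" by blast
  qed
  then have "vc_dim (f ` X) ((`) f ` \<C>) = vc_dim X \<C>" by (simp add: vc_dim_def)
  moreover have "card (trace ((`) f ` \<C>) B) = Phi d (card B)" if B: "B \<subseteq> f ` X" "finite B" for B
  proof -
    obtain A where A: "A \<subseteq> X" "B = f ` A" using B(1) by (rule subset_imageE)
    have "finite A" using B(2) A(2) size(1)[OF A(1)] by simp
    have "card (trace ((`) f ` \<C>) B) = card (trace \<C> A)"
      unfolding A(2) trace_image[OF f sub A(1)] by (rule card_image[OF inj_on_image_trace[OF f A(1)]])
    also have "\<dots> = Phi d (card A)"
      using max A(1) \<open>finite A\<close> unfolding d_maximum_def by blast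
    also have "card A = card B" unfolding A(2) by (rule size(2)[OF A(1), symmetric])
    finally show ?thesis .
  qed
  moreover have "(`) f ` \<C> \<subseteq> Pow (f ` X)" using sub by auto
  ultimately show ?thesis using max unfolding d_maximum_def by simp
qed

lemma interprets_infinite_maximumI:
  fixes X :: "'x set" and M :: "('f, 'r, 'm) struct"
  assumes "infinite X" and max: "d_maximum d X \<C>" and int: "interprets L M n X \<C>"
  shows "interprets_infinite_maximum L M n d"
proof -
  obtain k \<phi> f where *: "\<phi> \<in> formulas L (k + n)" "inj_on f X" "f ` X \<subseteq> tuples (univ M) k"
    "\<forall>c\<in>\<C>. \<exists>bs\<in>tuples (univ M) n. f ` c = {as \<in> f ` X. holds M \<phi> (as @ bs)}"
    using int unfolding interprets_def by blast
  have "infinite (f ` X)" using * assms(1) by (simp add: finite_image_iff)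
  moreover have "d_maximum d (f ` X) ((`) f ` \<C>)" using d_maximum_image[OF *(2) max] .
  moreover have "interprets L M n (f ` X) ((`) f ` \<C>)"
    unfolding interprets_def
    by (rule exI[of _ k], rule bexI[of _ \<phi>], rule exI[of _ "\<lambda>x. x"]) (use * in auto)
  ultimately show ?thesis unfolding interprets_infinite_maximum_def by blast
qed

end

theory Submission
  imports Defs "HOL-Library.Infinite_Set" "HOL-Library.Countable_Set"
begin

text \<open>A \<open>d\<close>-maximum family omits exactly one trace, its forbidden label, on each set of \<open>d + 1\<close>
  elements, and by the Sauer--Shelah bound its trace on a finite set consists of all words avoiding
  these labels. By Ramsey's theorem the label may be assumed to be one fixed word \<open>\<eta>\<close> of length
  \<open>d + 1\<close> on an infinite sequence. A word avoiding \<open>\<eta>\<close> that follows \<open>\<not> \<eta> i\<close> except at the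
  \<open>i\<close>-th of \<open>d\<close> odd positions, where it equals \<open>\<eta> i\<close>, is constant on all consecutive pairs of
  positions but the chosen ones; so the exclusive or of two copies of the formula, together with
  saturation, interprets \<open>[\<omega>]\<^sup>d\<close>. Splitting \<open>\<omega>\<close> into \<open>d\<close> infinite rows turns an
  interpretation of \<open>[\<omega>]\<^sup>d\<close> into an ICT pattern, and conversely the disjunction of the formulas of
  an ICT pattern interprets \<open>[\<omega>]\<^sup>d\<close> in the columns of its parameters.\<close>

subsection \<open>Maximum families\<close>

lemma card_subsets_le:
  assumes "finite A"
  shows "card {B. B \<subseteq> A \<and> card B \<le> d} = (\<Sum>i\<le>d. card A choose i)"
proof -
  have "{B. B \<subseteq> A \<and> card B \<le> d} = (\<Union>i\<in>{..d}. {B. B \<subseteq> A \<and> card B = i})" by auto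
  also have "card \<dots> = (\<Sum>i\<le>d. card {B. B \<subseteq> A \<and> card B = i})"
    by (rule card_UN_disjoint) (use assms in auto)
  finally show ?thesis using n_subsets[OF assms] by simp
qed

text \<open>Binomials vanish beyond \<open>m\<close> and a full row sums to \<open>2 ^ m\<close>, so
  a single sum covers both cases of \<open>Phi\<close>.\<close>

lemma Phi_eq: "Phi d m = (\<Sum>i\<le>d. m choose i)"
proof (cases "d \<le> m")
  case True
  then show ?thesis by (simp add: Phi_def atLeast0AtMost)
next
  case False
  then have "(\<Sum>i\<le>d. m choose i) = (\<Sum>i\<le>m. m choose i)"
    by (intro sum.mono_neutral_right) auto
  then show ?thesis using False by (simp add: Phi_def choose_row_sum)
qed

section \<open>Shattering and the Sauer--Shelah bound\<close>

lemma shatters_altdef: "shatters F B \<longleftrightarrow> (\<forall>D\<subseteq>B. \<exists>c\<in>F. c \<inter> B = D)"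
proof -
  have "shatters F B \<longleftrightarrow> Pow B \<subseteq> trace F B"
    unfolding shatters_def trace_def by (auto simp del: Pow_iff)
  also have "\<dots> \<longleftrightarrow> (\<forall>D\<subseteq>B. D \<in> trace F B)" by auto
  also have "\<dots> \<longleftrightarrow> (\<forall>D\<subseteq>B. \<exists>c\<in>F. c \<inter> B = D)"
    unfolding trace_def mem_Collect_eq by metis
  finally show ?thesis .
qed

lemma shatters_subset:
  assumes "shatters F B" "B' \<subseteq> B"
  shows "shatters F B'"
  unfolding shatters_altdef
proof (intro allI impI)
  fix D assume "D \<subseteq> B'"
  with assms obtain c where "c \<in> F" "c \<inter> B = D" unfolding shatters_altdef by blast
  with \<open>D \<subseteq> B'\<close> assms(2) show "\<exists>c\<in>F. c \<inter> B' = D" by blast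
qed

text \<open>Pajor's form of the Sauer--Shelah lemma, which unlike the numerical bound can be proved
  directly by induction.\<close>

lemma card_le_card_shattered:
  assumes "finite A" "F \<subseteq> Pow A"
  shows "card F \<le> card {B. B \<subseteq> A \<and> shatters F B}"
  using assms
proof (induction A arbitrary: F rule: finite_induct)
  case empty
  show ?case
  proof (cases "F = {}")
    case False
    with empty have F: "F = {{}}" by auto
    then have "{B. B \<subseteq> {} \<and> shatters F B} = {{}}" by (auto simp: shatters_altdef)
    then show ?thesis unfolding F by simp
  qed simp
next
  case (insert a A)
  \<comment> \<open>\<open>G\<close> projects \<open>F\<close> to \<open>A\<close>, and
    \<open>H\<close> records where two members are identified by this projection. Sets shattered by
    \<open>G\<close> are shattered by \<open>F\<close> and avoid \<open>a\<close>; those shattered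
    by \<open>H\<close> remain shattered by \<open>F\<close> after inserting
    \<open>a\<close>.\<close>
  define G where "G = (\<lambda>c. c - {a}) ` F"
  define H where "H = {c. c \<subseteq> A \<and> c \<in> F \<and> insert a c \<in> F}"
  let ?S = "\<lambda>A F. {B. B \<subseteq> A \<and> shatters F B}"
  have finF: "finite F" using insert by (meson finite_Pow_iff finite_insert finite_subset)
  \<comment> \<open>Inclusion-exclusion gives \<open>card F = card G + card H\<close>: after
    deletion of \<open>a\<close>, the members containing \<open>a\<close> (\<open>P'\<close>) and
    the others (\<open>Q\<close>) have union \<open>G\<close> and intersection
    \<open>H\<close>.\<close>
  define P where "P = {c \<in> F. a \<in> c}"
  define Q where "Q = {c \<in> F. a \<notin> c}"
  define P' where "P' = (\<lambda>c. c - {a}) ` P"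
  have fPQ: "finite P" "finite Q" using finF by (auto simp: P_def Q_def)
  have "F = P \<union> Q" "P \<inter> Q = {}" by (auto simp: P_def Q_def)
  then have "card F = card P + card Q" using fPQ by (simp add: card_Un_disjoint)
  moreover have "card P = card P'"
    unfolding P'_def
    by (rule card_image[symmetric], rule inj_onI) (metis (no_types, lifting) P_def insert_Diff mem_Collect_eq)
  moreover have "G = P' \<union> Q"
  proof -
    have "G = P' \<union> (\<lambda>c. c - {a}) ` Q" unfolding G_def P'_def using \<open>F = P \<union> Q\<close> by blast
    moreover have "(\<lambda>c. c - {a}) ` Q = Q" by (force simp: Q_def)
    ultimately show ?thesis by simp
  qed
  moreover have "H = P' \<inter> Q"
  proof (intro equalityI subsetI)
    fix c assume c: "c \<in> H"
    then have "a \<notin> c" using insert.hyps(2) by (auto simp: H_def)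
    then have "c = insert a c - {a}" by auto
    with c \<open>a \<notin> c\<close> show "c \<in> P' \<inter> Q" unfolding P'_def P_def Q_def H_def by blast
  next
    fix c assume c: "c \<in> P' \<inter> Q"
    then obtain e where "e \<in> F" "a \<in> e" "c = e - {a}" by (auto simp: P'_def P_def)
    then have "insert a c = e" by auto
    with c \<open>e \<in> F\<close> insert.prems show "c \<in> H" unfolding H_def Q_def by auto
  qed
  ultimately have "card F = card G + card H"
    using card_Un_Int[of P' Q] fPQ by (simp add: P'_def)
  also have "\<dots> \<le> card (?S A G) + card (?S A H)"
    by (intro add_mono insert.IH) (use insert.prems in \<open>auto simp: G_def H_def\<close>)
  also have "card (?S A H) = card (insert a ` ?S A H)"
    by (rule card_image[symmetric]) (use insert.hyps(2) in \<open>auto simp: inj_on_def\<close>)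
  also have "card (?S A G) + card (insert a ` ?S A H) = card (?S A G \<union> insert a ` ?S A H)"
    by (rule card_Un_disjoint[symmetric]) (use insert.hyps in auto)
  also have "\<dots> \<le> card (?S (insert a A) F)"
  proof (rule card_mono)
    show "finite (?S (insert a A) F)" using insert.hyps(1) by auto
    have "shatters F B" if "B \<subseteq> A" "shatters G B" for B
      unfolding shatters_altdef
    proof (intro allI impI)
      fix D assume "D \<subseteq> B"
      with that(2) obtain c where "c \<in> F" "(c - {a}) \<inter> B = D" unfolding shatters_altdef G_def by blast
      then show "\<exists>c\<in>F. c \<inter> B = D" using that(1) insert.hyps(2) by blast
    qed
    moreover have "shatters F (insert a B)" if "B \<subseteq> A" "shatters H B" for B
      unfolding shatters_altdef
    proof (intro allI impI)
      fix D assume D: "D \<subseteq> insert a B"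
      then have "D - {a} \<subseteq> B" by auto
      with that(2) obtain c where c: "c \<in> H" "c \<inter> B = D - {a}" unfolding shatters_altdef by blast
      have "a \<notin> B" "a \<notin> c" using that(1) insert.hyps(2) c(1) by (auto simp: H_def)
      show "\<exists>c\<in>F. c \<inter> insert a B = D"
      proof (cases "a \<in> D")
        case True
        then have "insert a c \<inter> insert a B = D" using c(2) by blast
        then show ?thesis using c(1) unfolding H_def by blast
      next
        case False
        have "c \<inter> insert a B = c \<inter> B" using \<open>a \<notin> c\<close> by blast
        also have "\<dots> = D" using c(2) False by simp
        finally show ?thesis using c(1) unfolding H_def by blast
      qed
    qed
    ultimately show "?S A G \<union> insert a ` ?S A H \<subseteq> ?S (insert a A) F" by blast
  qed
  finally show ?case .
qed

text \<open>A shattered set with more than \<open>d\<close> elements would have a shattered subset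
  with exactly \<open>d + 1\<close>, so Pajor's count runs only over subsets of size at most
  \<open>d\<close>.\<close>

lemma sauer_shelah:
  assumes "finite A" "F \<subseteq> Pow A"
    and no: "\<And>B. B \<subseteq> A \<Longrightarrow> card B = Suc d \<Longrightarrow> \<not> shatters F B"
  shows "card F \<le> Phi d (card A)"
proof -
  have "card B \<le> d" if "B \<subseteq> A" "shatters F B" for B
  proof (rule ccontr)
    assume "\<not> card B \<le> d"
    then obtain B' where "B' \<subseteq> B" "card B' = Suc d"
      by (metis not_less_eq_eq obtain_subset_with_card_n)
    then show False using no[of B'] shatters_subset that by blast
  qed
  then have "{B. B \<subseteq> A \<and> shatters F B} \<subseteq> {B. B \<subseteq> A \<and> card B \<le> d}" by auto
  with assms(1) have "card {B. B \<subseteq> A \<and> shatters F B} \<le> card {B. B \<subseteq> A \<and> card B \<le> d}"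
    by (intro card_mono) auto
  with card_le_card_shattered[OF assms(1,2)] show ?thesis
    by (simp add: card_subsets_le[OF assms(1)] Phi_eq)
qed

text \<open>On a finite set, all subsets of size at most \<open>d\<close> arise as traces, since
  missing elements can be added outside that set. Thus condition (2) is an instance of condition
  (1).\<close>

lemma d_maximum_nsets: "d_maximum d (UNIV :: nat set) (nsets UNIV d)"
proof -
  have tr: "trace (nsets UNIV d) A = {B. B \<subseteq> A \<and> finite B \<and> card B \<le> d}"
    if "finite A" for A :: "nat set"
  proof (intro equalityI subsetI)
    fix B assume "B \<in> trace (nsets UNIV d) A"
    then show "B \<in> {B. B \<subseteq> A \<and> finite B \<and> card B \<le> d}"
      by (auto simp: trace_def nsets_def intro: card_mono)
  next
    fix B assume B: "B \<in> {B. B \<subseteq> A \<and> finite B \<and> card B \<le> d}"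
    have "infinite (UNIV - A)" using that by simp
    then obtain E where E: "finite E" "card E = d - card B" "E \<subseteq> UNIV - A"
      by (meson infinite_arbitrarily_large)
    then have "B \<inter> E = {}" "(B \<union> E) \<inter> A = B" using B by auto
    then have "card (B \<union> E) = d" "(B \<union> E) \<inter> A = B"
      using B E by (simp_all add: card_Un_disjoint)
    then show "B \<in> trace (nsets UNIV d) A"
      using B E(1) unfolding trace_def nsets_def by blast
  qed
  \<comment> \<open>Shattering \<open>A\<close> requires a member containing all of
    \<open>A\<close>; in particular no infinite set enters the supremum.\<close>
  have small: "finite A \<and> card A \<le> d" if "shatters (nsets UNIV d) A" for A :: "nat set"
  proof -
    from that obtain c where "c \<in> nsets UNIV d" "c \<inter> A = A" unfolding shatters_altdef by blast
    then show ?thesis by (auto simp: nsets_def intro: finite_subset card_mono)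
  qed
  have "shatters (nsets UNIV d) {..<d}"
    unfolding shatters_def tr[OF finite_lessThan]
    using card_mono[OF finite_lessThan, of _ d] finite_subset[OF _ finite_lessThan, of _ d] by auto
  then have "enat d \<in> {if finite A then enat (card A) else \<infinity> | A. A \<subseteq> (UNIV :: nat set) \<and> shatters (nsets UNIV d) A}"
    by (intro CollectI exI[of _ "{..<d}"]) simp
  then have "vc_dim (UNIV :: nat set) (nsets UNIV d) = enat d"
    unfolding vc_dim_def by (intro antisym Sup_least Sup_upper) (auto dest!: small)
  moreover have "card (trace (nsets UNIV d) A) = Phi d (card A)" if "finite A" for A :: "nat set"
  proof -
    have "trace (nsets UNIV d) A = {B. B \<subseteq> A \<and> card B \<le> d}"
      unfolding tr[OF that] using finite_subset[OF _ that] by auto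
    then show ?thesis using card_subsets_le[OF that] by (simp add: Phi_eq)
  qed
  ultimately show ?thesis by (simp add: d_maximum_def)
qed

section \<open>Ranks and uniform forbidden labels\<close>

text \<open>For \<open>x \<in> B\<close> this is the zero-based index of \<open>x\<close> in the
  increasing enumeration of \<open>B\<close>. A set of indices can then describe labels on all sets
  of \<open>d + 1\<close> elements simultaneously.\<close>

definition rank :: "nat set \<Rightarrow> nat \<Rightarrow> nat" where
  "rank B x = card (B \<inter> {..<x})"

lemma rank_Suc: "rank B (Suc x) = (if x \<in> B then Suc (rank B x) else rank B x)"
proof -
  have "B \<inter> {..<Suc x} = (if x \<in> B then insert x (B \<inter> {..<x}) else B \<inter> {..<x})"
    by (auto simp: less_Suc_eq)
  then show ?thesis by (simp add: rank_def)
qed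

lemma rank_less:
  assumes "x \<in> B" "x < y"
  shows "rank B x < rank B y"
  unfolding rank_def by (rule psubset_card_mono) (use assms in auto)

lemma inj_on_rank: "inj_on (rank B) B"
  by (rule linorder_inj_onI) (use rank_less in \<open>fastforce+\<close>)

text \<open>Labels expressed through ranks survive the passage to a subsequence.\<close>

lemma rank_image:
  assumes "strict_mono h"
  shows "rank (h ` B) (h x) = rank B x"
proof -
  have "h ` B \<inter> {..<h x} = h ` (B \<inter> {..<x})" using strict_mono_less[OF assms] by auto
  then show ?thesis unfolding rank_def
    by (simp add: card_image[OF inj_on_subset[OF strict_mono_imp_inj_on[OF assms] subset_UNIV]])
qed

lemma uniform_forbidden_label:
  fixes \<C> :: "nat set set"
  assumes ex: "\<And>B. finite B \<Longrightarrow> card B = Suc d \<Longrightarrow> \<not> shatters \<C> B"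
  obtains h :: "nat \<Rightarrow> nat" and \<eta> :: "nat set" where "strict_mono h"
    "\<And>B c. finite B \<Longrightarrow> card B = Suc d \<Longrightarrow> c \<in> \<C> \<Longrightarrow> h -` c \<inter> B \<noteq> {x \<in> B. rank B x \<in> \<eta>}"
proof -
  have "\<exists>D\<subseteq>B. \<forall>c\<in>\<C>. c \<inter> B \<noteq> D" if "finite B" "card B = Suc d" for B
    using ex[OF that] unfolding shatters_altdef by blast
  then obtain F where F: "\<And>B. finite B \<Longrightarrow> card B = Suc d \<Longrightarrow> F B \<subseteq> B"
    "\<And>B c. finite B \<Longrightarrow> card B = Suc d \<Longrightarrow> c \<in> \<C> \<Longrightarrow> c \<inter> B \<noteq> F B"
    by metis
  \<comment> \<open>The colour of \<open>B\<close> is its omitted trace \<open>F B\<close>, written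
    in ranks to make different sets comparable.\<close>
  define col where "col B = rank B ` F B" for B
  have col: "col B \<in> Pow {..<Suc d}" if "finite B" "card B = Suc d" for B
  proof -
    have "rank B x < card B" if "x \<in> B" for x
      unfolding rank_def by (rule psubset_card_mono) (use that \<open>finite B\<close> in auto)
    then show ?thesis using F(1)[OF that] that by (auto simp: col_def)
  qed
  \<comment> \<open>\<open>Ramsey\<close> colours with natural numbers, so the finitely many
    possible labels are numbered.\<close>
  obtain code :: "nat set \<Rightarrow> nat" where code: "bij_betw code (Pow {..<Suc d}) {0..<card (Pow {..<Suc d})}"
    using ex_bij_betw_finite_nat[of "Pow {..<Suc d}"] by auto
  have "\<forall>B. B \<subseteq> UNIV \<and> finite B \<and> card B = Suc d \<longrightarrow> code (col B) < card (Pow {..<Suc d})"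
    using col bij_betwE[OF code] by auto
  from Ramsey[OF infinite_UNIV_nat this] obtain Y t where Y: "infinite Y"
    "\<forall>B. B \<subseteq> Y \<and> finite B \<and> card B = Suc d \<longrightarrow> code (col B) = t" by blast
  define \<eta> where "\<eta> = inv_into (Pow {..<Suc d}) code t"
  have \<eta>: "col B = \<eta>" if "B \<subseteq> Y" "finite B" "card B = Suc d" for B
    unfolding \<eta>_def using Y(2) that col[of B] code
    by (metis bij_betw_imp_inj_on inv_into_f_f)
  have mono: "strict_mono (enumerate Y)" using Y(1) by (rule strict_mono_enumerate)
  show ?thesis
  proof (rule that[OF mono, of \<eta>])
    fix B :: "nat set" and c assume B: "finite B" "card B = Suc d" "c \<in> \<C>"
    let ?h = "enumerate Y" and ?B = "enumerate Y ` B"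
    have inj: "inj ?h" using mono by (rule strict_mono_imp_inj_on)
    have B': "?B \<subseteq> Y" "finite ?B" "card ?B = Suc d"
      using B enumerate_in_set[OF Y(1)] by (auto simp: card_image[OF inj_on_subset[OF inj]])
    \<comment> \<open>Ranks are injective on the set, so the omitted trace can be recovered from its
      colour.\<close>
    have "rank ?B z \<in> col ?B \<longleftrightarrow> z \<in> F ?B" if "z \<in> ?B" for z
      unfolding col_def using inj_on_image_mem_iff[OF inj_on_rank that F(1)[OF B'(2,3)]] .
    then have "F ?B = {z \<in> ?B. rank ?B z \<in> \<eta>}"
      using F(1)[OF B'(2,3)] \<eta>[OF B'] by blast
    also have "\<dots> = ?h ` {x \<in> B. rank B x \<in> \<eta>}"
      by (auto simp: rank_image[OF mono])
    finally have "c \<inter> ?B \<noteq> ?h ` {x \<in> B. rank B x \<in> \<eta>}" using F(2)[OF B'(2,3) B(3)] by simp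
    moreover have "c \<inter> ?B = ?h ` (?h -` c \<inter> B)" by auto
    ultimately show "?h -` c \<inter> B \<noteq> {x \<in> B. rank B x \<in> \<eta>}" by auto
  qed
qed

text \<open>\<open>alt_word \<eta> P\<close> is the word which avoids the label \<open>\<eta>\<close> and in which the greedy search for \<open>\<eta>\<close>
  as a subsequence advances exactly at the positions in \<open>P\<close>.\<close>

definition alt_word :: "nat set \<Rightarrow> nat set \<Rightarrow> nat set" where
  "alt_word \<eta> P = {x. rank P x \<in> \<eta> \<longleftrightarrow> x \<in> P}"

text \<open>If the word carried \<open>\<eta>\<close> on \<open>B\<close>, the rank in
  \<open>B\<close> could never overtake the rank in \<open>P\<close>, which would force
  \<open>card B \<le> card P\<close>.\<close>

lemma alt_word_avoids:
  assumes P: "finite P" "card P < card B" and B: "finite B"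
  shows "alt_word \<eta> P \<inter> B \<noteq> {x \<in> B. rank B x \<in> \<eta>}"
proof
  assume eq: "alt_word \<eta> P \<inter> B = {x \<in> B. rank B x \<in> \<eta>}"
  have "rank B x \<le> rank P x" for x
  proof (induction x)
    case (Suc x)
    show ?case
    \<comment> \<open>Only here could the inequality break. The letter at \<open>x\<close> then
      equals the letter of \<open>\<eta>\<close> at \<open>rank P x\<close>, so \<open>x\<close>
      lies in \<open>P\<close> and both ranks advance.\<close>
    proof (cases "x \<in> B \<and> rank B x = rank P x")
      case True
      then have "x \<in> alt_word \<eta> P \<longleftrightarrow> rank B x \<in> \<eta>" using eq by blast
      with True have "x \<in> P" unfolding alt_word_def mem_Collect_eq by metis
      with True show ?thesis by (simp add: rank_Suc)
    next
      case False
      with Suc show ?thesis by (auto simp: rank_Suc)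
    qed
  qed (simp add: rank_def)
  \<comment> \<open>Beyond all of \<open>B\<close> the rank in \<open>B\<close> has reached
    \<open>card B\<close>, while the rank in \<open>P\<close> is at most
    \<open>card P\<close>.\<close>
  moreover obtain N where "B \<subseteq> {..<N}" using B finite_nat_bounded by blast
  then have "rank B N = card B" by (simp add: rank_def Int_absorb2)
  moreover have "rank P N \<le> card P" unfolding rank_def using P by (intro card_mono) auto
  ultimately show False using P(2) by (metis not_le order_trans)
qed

text \<open>The set of odd positions does not contain \<open>2 * j\<close>, so both positions have
  the same rank. The letter at \<open>2 * j\<close> is opposite to \<open>\<eta>\<close> at that
  rank; the next one differs from it exactly if \<open>2 * j + 1\<close> is a chosen
  position.\<close>

lemma alt_word_odd:
  "(2 * j \<in> alt_word \<eta> ((\<lambda>m. 2 * m + 1) ` S)) \<noteq> (2 * j + 1 \<in> alt_word \<eta> ((\<lambda>m. 2 * m + 1) ` S))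
     \<longleftrightarrow> j \<in> S"
proof -
  let ?P = "(\<lambda>m. 2 * m + 1) ` S"
  have "2 * j \<notin> ?P"
  proof
    assume "2 * j \<in> ?P"
    then obtain m where "2 * j = 2 * m + 1" by blast
    then show False by presburger
  qed
  moreover have "2 * j + 1 \<in> ?P \<longleftrightarrow> j \<in> S" by (simp add: image_iff)
  moreover from calculation have "rank ?P (2 * j + 1) = rank ?P (2 * j)"
    unfolding Suc_eq_plus1[symmetric] by (simp add: rank_Suc)
  ultimately show ?thesis unfolding alt_word_def mem_Collect_eq by metis
qed

text \<open>On an initial segment of the subsequence, maximality provides as many traces as the
  Sauer--Shelah bound allows words avoiding \<open>\<eta>\<close>. Hence every avoiding word is a
  trace, in particular \<open>alt_word \<eta> P\<close>. The member \<open>c\<close> depends on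
  \<open>N\<close>.\<close>

lemma maximum_realizes_alt_words:
  fixes \<C> :: "nat set set"
  assumes max: "\<And>A. finite A \<Longrightarrow> card (trace \<C> A) = Phi d (card A)"
  obtains h :: "nat \<Rightarrow> nat" and \<eta> :: "nat set" where "strict_mono h"
    "\<And>P N. finite P \<Longrightarrow> card P = d \<Longrightarrow> \<exists>c\<in>\<C>. \<forall>j<N. h j \<in> c \<longleftrightarrow> j \<in> alt_word \<eta> P"
proof -
  \<comment> \<open>Shattering would need all \<open>2 ^ Suc d\<close> traces, but the sum for
    \<open>Phi\<close> lacks the last binomial of that row.\<close>
  have not_sh: "\<not> shatters \<C> B" if "finite B" "card B = Suc d" for B
  proof
    assume "shatters \<C> B"
    then have "card (trace \<C> B) = 2 ^ Suc d" unfolding shatters_def using that card_Pow by metis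
    moreover have "card (trace \<C> B) = (\<Sum>i\<le>d. Suc d choose i)" using max[OF that(1)] that(2) by (simp add: Phi_eq)
    moreover have "(\<Sum>i\<le>Suc d. Suc d choose i) = 2 ^ Suc d" by (rule choose_row_sum)
    ultimately show False by simp
  qed
  obtain h :: "nat \<Rightarrow> nat" and \<eta> where h: "strict_mono h" and avoid:
    "\<And>B c. finite B \<Longrightarrow> card B = Suc d \<Longrightarrow> c \<in> \<C> \<Longrightarrow> h -` c \<inter> B \<noteq> {x \<in> B. rank B x \<in> \<eta>}"
    using uniform_forbidden_label[of d \<C>] not_sh by blast
  have inj: "inj h" using h by (rule strict_mono_imp_inj_on)
  show ?thesis
  proof (rule that[OF h, of \<eta>])
    fix P :: "nat set" and N :: nat
    assume P: "finite P" "card P = d"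
    define E where "E = {v. v \<subseteq> {..<N} \<and>
      (\<forall>B. B \<subseteq> {..<N} \<and> card B = Suc d \<longrightarrow> v \<inter> B \<noteq> {x \<in> B. rank B x \<in> \<eta>})}"
    let ?tr = "(\<lambda>c. h -` c \<inter> {..<N}) ` \<C>"
    have finE: "finite E" by (rule finite_subset[of _ "Pow {..<N}"]) (auto simp: E_def)
    have "?tr \<subseteq> E"
    proof (rule image_subsetI)
      fix c assume c: "c \<in> \<C>"
      have "h -` c \<inter> {..<N} \<inter> B \<noteq> {x \<in> B. rank B x \<in> \<eta>}" if B: "B \<subseteq> {..<N}" "card B = Suc d" for B
      proof -
        have "h -` c \<inter> {..<N} \<inter> B = h -` c \<inter> B" using B by auto
        then show ?thesis using avoid[OF _ B(2) c] finite_subset[OF B(1)] by simp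
      qed
      then show "h -` c \<inter> {..<N} \<in> E" by (simp add: E_def)
    qed
    moreover have "card E \<le> card ?tr"
    proof -
      have "card E \<le> Phi d (card {..<N})"
      proof (rule sauer_shelah)
        \<comment> \<open>Shattering \<open>B\<close> would include the very word on
          \<open>B\<close> that members of \<open>E\<close> avoid.\<close>
        show "\<not> shatters E B" if "B \<subseteq> {..<N}" "card B = Suc d" for B
        proof
          assume "shatters E B"
          moreover have "{x \<in> B. rank B x \<in> \<eta>} \<subseteq> B" by blast
          ultimately obtain v where "v \<in> E" "v \<inter> B = {x \<in> B. rank B x \<in> \<eta>}"
            unfolding shatters_altdef by metis
          then show False using that unfolding E_def by simp
        qed
      qed (auto simp: E_def)
      also have "\<dots> = Phi d (card (h ` {..<N}))" by (simp add: card_image[OF inj_on_subset[OF inj]])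
      also have "\<dots> = card (trace \<C> (h ` {..<N}))" by (rule max[symmetric]) simp
      also have "trace \<C> (h ` {..<N}) = (`) h ` ?tr"
        unfolding trace_def Setcompr_eq_image image_image by (rule image_cong) auto
      also have "card \<dots> = card ?tr"
        by (rule card_image) (use inj in \<open>auto simp: inj_on_def inj_image_eq_iff\<close>)
      finally show ?thesis .
    qed
    ultimately have "?tr = E" using finE by (simp add: card_seteq)
    moreover have "alt_word \<eta> P \<inter> {..<N} \<in> E"
    proof -
      have "alt_word \<eta> P \<inter> {..<N} \<inter> B \<noteq> {x \<in> B. rank B x \<in> \<eta>}"
        if B: "B \<subseteq> {..<N}" "card B = Suc d" for B
      proof -
        have "alt_word \<eta> P \<inter> {..<N} \<inter> B = alt_word \<eta> P \<inter> B" using B by auto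
        moreover have "finite B" using B(1) by (rule finite_subset) simp
        ultimately show ?thesis using alt_word_avoids[of P B \<eta>] P B by simp
      qed
      then show ?thesis by (simp add: E_def)
    qed
    ultimately have "alt_word \<eta> P \<inter> {..<N} \<in> ?tr" by simp
    then obtain c where "c \<in> \<C>" "h -` c \<inter> {..<N} = alt_word \<eta> P \<inter> {..<N}"
      by (metis (no_types, lifting) imageE)
    then show "\<exists>c\<in>\<C>. \<forall>j<N. h j \<in> c \<longleftrightarrow> j \<in> alt_word \<eta> P" by blast
  qed
qed

subsection \<open>Formulas and types\<close>

primrec rename_term :: "(nat \<Rightarrow> nat) \<Rightarrow> 'f fo_term \<Rightarrow> 'f fo_term" where
  "rename_term g (Var i) = Var (g i)"
| "rename_term g (Fun f ts) = Fun f (map (rename_term g) ts)"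

text \<open>Bound variables are renamed along with free ones, so an injective \<open>g\<close>
  causes no capture and no fresh variables have to be chosen.\<close>

primrec rename :: "(nat \<Rightarrow> nat) \<Rightarrow> ('f, 'r) formula \<Rightarrow> ('f, 'r) formula" where
  "rename g (Equal s t) = Equal (rename_term g s) (rename_term g t)"
| "rename g (Rel r ts) = Rel r (map (rename_term g) ts)"
| "rename g (Neg \<phi>) = Neg (rename g \<phi>)"
| "rename g (Conj \<phi> \<psi>) = Conj (rename g \<phi>) (rename g \<psi>)"
| "rename g (Exists i \<phi>) = Exists (g i) (rename g \<phi>)"

lemma eval_rename_term: "eval_term M s (rename_term g t) = eval_term M (\<lambda>i. s (g i)) t"
proof (induction t)
  case (Fun f ts)
  then have "map (eval_term M s \<circ> rename_term g) ts = map (eval_term M (\<lambda>i. s (g i))) ts"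
    by (intro map_cong refl) simp
  then show ?case by (simp only: eval_term.simps rename_term.simps map_map)
qed simp

lemma vars_rename_term: "vars_term (rename_term g t) = g ` vars_term t"
  by (induction t) auto

lemma wf_rename_term: "wf_term L (rename_term g t) = wf_term L t"
  by (induction t) (auto simp: list_all_iff)

lemma sat_rename:
  assumes "inj g"
  shows "sat M s (rename g \<phi>) \<longleftrightarrow> sat M (\<lambda>i. s (g i)) \<phi>"
proof (induction \<phi> arbitrary: s)
  case (Exists j \<phi>)
  have "(\<lambda>i. (s(g j := a)) (g i)) = (\<lambda>i. s (g i))(j := a)" for a
    using inj_eq[OF assms] by (auto simp: fun_eq_iff)
  with Exists show ?case by simp
qed (simp_all add: eval_rename_term comp_def)

lemma free_vars_rename:
  assumes "inj g"
  shows "free_vars (rename g \<phi>) = g ` free_vars \<phi>"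
  by (induction \<phi>) (auto simp: vars_rename_term inj_eq[OF assms])

lemma wf_rename: "wf_formula L (rename g \<phi>) = wf_formula L \<phi>"
  by (induction \<phi>) (auto simp: wf_rename_term list_all_iff)

lemma eval_term_cong:
  "(\<And>i. i \<in> vars_term t \<Longrightarrow> s i = s' i) \<Longrightarrow> eval_term M s t = eval_term M s' t"
proof (induction t)
  case (Fun f ts)
  then have "map (eval_term M s) ts = map (eval_term M s') ts" by (intro map_cong refl) auto
  then show ?case by (simp only: eval_term.simps)
qed simp

lemma sat_cong:
  "(\<And>i. i \<in> free_vars \<phi> \<Longrightarrow> s i = s' i) \<Longrightarrow> sat M s \<phi> \<longleftrightarrow> sat M s' \<phi>"
proof (induction \<phi> arbitrary: s s')
  case (Equal t u)
  then have "eval_term M s t = eval_term M s' t" "eval_term M s u = eval_term M s' u"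
    by (auto intro: eval_term_cong)
  then show ?case by simp
next
  case (Rel r ts)
  then have "map (eval_term M s) ts = map (eval_term M s') ts"
    by (intro map_cong refl eval_term_cong) auto
  then show ?case by (simp only: sat.simps)
next
  case (Neg \<phi>)
  have "sat M s \<phi> = sat M s' \<phi>" by (rule Neg.IH) (use Neg.prems in simp)
  then show ?case by simp
next
  case (Conj \<phi> \<psi>)
  have "sat M s \<phi> = sat M s' \<phi>" by (rule Conj.IH(1)) (use Conj.prems in simp)
  moreover have "sat M s \<psi> = sat M s' \<psi>" by (rule Conj.IH(2)) (use Conj.prems in simp)
  ultimately show ?case by simp
next
  case (Exists j \<phi>)
  have "sat M (s(j := a)) \<phi> = sat M (s'(j := a)) \<phi>" for a
    by (rule Exists.IH) (use Exists.prems in auto)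
  then show ?case by simp
qed

lemma formulas_mono: "\<phi> \<in> formulas L k \<Longrightarrow> k \<le> k' \<Longrightarrow> \<phi> \<in> formulas L k'"
  by (auto simp: formulas_def)

lemma Neg_formulas [simp]: "Neg \<phi> \<in> formulas L k \<longleftrightarrow> \<phi> \<in> formulas L k"
  by (simp add: formulas_def)

lemma Conj_formulas [simp]: "Conj \<phi> \<psi> \<in> formulas L k \<longleftrightarrow> \<phi> \<in> formulas L k \<and> \<psi> \<in> formulas L k"
  by (auto simp: formulas_def)

lemma holds_Neg [simp]: "holds M (Neg \<phi>) as \<longleftrightarrow> \<not> holds M \<phi> as"
  by (simp add: holds_def)

lemma holds_Conj [simp]: "holds M (Conj \<phi> \<psi>) as \<longleftrightarrow> holds M \<phi> as \<and> holds M \<psi> as"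
  by (simp add: holds_def)

text \<open>A closed tautology: \<open>Equal (Var 0) (Var 0)\<close> is not in \<open>formulas L 0\<close>.\<close>

definition Truth :: "('f, 'r) formula" where
  "Truth = Neg (Exists 0 (Neg (Equal (Var 0) (Var 0))))"

lemma Truth [simp]: "Truth \<in> formulas L k" "holds M Truth as"
  by (simp_all add: Truth_def formulas_def holds_def)

lemma rename_formula:
  fixes M :: "('f, 'r, 'm) struct"
  assumes \<phi>: "\<phi> \<in> formulas L k" and g: "inj_on g {..<k}" "\<And>i. i < k \<Longrightarrow> g i < k'"
  obtains \<phi>' where "\<phi>' \<in> formulas L k'"
    "\<And>as bs. (\<And>i. i < k \<Longrightarrow> as ! g i = bs ! i) \<Longrightarrow> holds M \<phi>' as \<longleftrightarrow> holds M \<phi> bs"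
proof -
  \<comment> \<open>The given map is injective only on the variables below \<open>k\<close>; all
    others are shifted past \<open>k'\<close> to make it injective everywhere.\<close>
  define g' where "g' i = (if i < k then g i else i + k')" for i
  have inj: "inj g'"
  proof (rule injI)
    fix x y assume eq: "g' x = g' y"
    then consider "x < k" "y < k" | "x \<ge> k" "y \<ge> k"
      using g(2)[of x] g(2)[of y] by (auto simp: g'_def split: if_splits)
    then show "x = y" using eq g(1) by cases (auto simp: g'_def inj_on_def)
  qed
  have fv: "free_vars \<phi> \<subseteq> {..<k}" using \<phi> by (simp add: formulas_def)
  show ?thesis
  proof
    show "rename g' \<phi> \<in> formulas L k'"
      using \<phi> g(2) by (auto simp: formulas_def wf_rename free_vars_rename[OF inj] g'_def subset_iff)
    show "holds M (rename g' \<phi>) as \<longleftrightarrow> holds M \<phi> bs" if "\<And>i. i < k \<Longrightarrow> as ! g i = bs ! i" for as bs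
      unfolding holds_def sat_rename[OF inj] by (rule sat_cong) (use that fv in \<open>auto simp: g'_def\<close>)
  qed
qed

text \<open>Interpretations put the parameters to be found in the second block of variables, types
  and ICT patterns in the first.\<close>

lemma swap_formula:
  fixes M :: "('f, 'r, 'm) struct"
  assumes "\<phi> \<in> formulas L (p + q)"
  obtains \<phi>' where "\<phi>' \<in> formulas L (q + p)"
    "\<And>as bs. length as = p \<Longrightarrow> length bs = q \<Longrightarrow> holds M \<phi>' (bs @ as) \<longleftrightarrow> holds M \<phi> (as @ bs)"
proof -
  let ?g = "\<lambda>i. if i < p then i + q else i - p"
  have "inj_on ?g {..<p + q}" "\<And>i. i < p + q \<Longrightarrow> ?g i < q + p" by (auto simp: inj_on_def)
  from rename_formula[OF assms this, of M] obtain \<phi>' where \<phi>': "\<phi>' \<in> formulas L (q + p)"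
    "\<And>as bs. (\<And>i. i < p + q \<Longrightarrow> as ! ?g i = bs ! i) \<Longrightarrow> holds M \<phi>' as \<longleftrightarrow> holds M \<phi> bs"
    by blast
  show ?thesis by (rule that[OF \<phi>'(1)], rule \<phi>'(2)) (auto simp: nth_append)
qed

text \<open>Binding variable 0 directly would leave the variables from 1 on. Moving the first
  variable to the end before binding keeps the numbering of the others.\<close>

lemma exists_first:
  fixes M :: "('f, 'r, 'm) struct"
  assumes "\<theta> \<in> formulas L (Suc m)"
  obtains \<theta>' where "\<theta>' \<in> formulas L m"
    "\<And>cs. length cs = m \<Longrightarrow> holds M \<theta>' cs \<longleftrightarrow> (\<exists>a\<in>univ M. holds M \<theta> (a # cs))"
proof -
  have "\<theta> \<in> formulas L (1 + m)" using assms by simp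
  from swap_formula[OF this, of M] obtain \<theta>' where \<theta>': "\<theta>' \<in> formulas L (m + 1)"
    "\<And>as bs. length as = 1 \<Longrightarrow> length bs = m \<Longrightarrow> holds M \<theta>' (bs @ as) \<longleftrightarrow> holds M \<theta> (as @ bs)"
    by blast
  show ?thesis
  proof
    show "Exists m \<theta>' \<in> formulas L m" using \<theta>'(1) by (auto simp: formulas_def)
    fix cs :: "'m list" assume cs: "length cs = m"
    \<comment> \<open>The bound index \<open>m\<close> lies just beyond \<open>cs\<close>, so
      updating the assignment there amounts to appending \<open>a\<close>.\<close>
    have "sat M ((\<lambda>i. cs ! i)(m := a)) \<theta>' \<longleftrightarrow> holds M \<theta>' (cs @ [a])" for a
      unfolding holds_def
      by (rule sat_cong) (use \<theta>'(1) cs in \<open>auto simp: formulas_def nth_append less_Suc_eq\<close>)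
    then show "holds M (Exists m \<theta>') cs \<longleftrightarrow> (\<exists>a\<in>univ M. holds M \<theta> (a # cs))"
      using \<theta>'(2)[of "[_]" cs] cs by (simp add: holds_def)
  qed
qed

section \<open>Quantifying over tuples and realizing types\<close>

lemma tuples_0 [simp]: "tuples A 0 = {[]}"
  by (auto simp: tuples_def)

lemma tuples_Suc: "tuples A (Suc n) = {as @ [a] | as a. as \<in> tuples A n \<and> a \<in> A}"
proof (intro equalityI subsetI)
  fix xs assume "xs \<in> tuples A (Suc n)"
  then show "xs \<in> {as @ [a] | as a. as \<in> tuples A n \<and> a \<in> A}"
    by (cases xs rule: rev_cases) (auto simp: tuples_def)
qed (auto simp: tuples_def)

lemma ex_tuples_Suc:
  "(\<exists>xs\<in>tuples A (Suc n). P xs) \<longleftrightarrow> (\<exists>a\<in>A. \<exists>as\<in>tuples A n. P (as @ [a]))"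
  unfolding tuples_Suc by blast

lemma exists_prefix:
  fixes M :: "('f, 'r, 'm) struct"
  assumes "\<theta> \<in> formulas L (n + k)"
  shows "\<exists>\<theta>'\<in>formulas L k. \<forall>cs. length cs = k \<longrightarrow>
           (holds M \<theta>' cs \<longleftrightarrow> (\<exists>as\<in>tuples (univ M) n. holds M \<theta> (as @ cs)))"
  using assms
proof (induction n arbitrary: k)
  case 0
  then show ?case by auto
next
  case (Suc n)
  \<comment> \<open>The last coordinate of the prefix counts as a parameter for the induction
    hypothesis and is bound afterwards by \<open>exists_first\<close>.\<close>
  then have "\<theta> \<in> formulas L (n + Suc k)" by simp
  from Suc.IH[OF this] obtain \<theta>1 where \<theta>1: "\<theta>1 \<in> formulas L (Suc k)"
    "\<forall>cs. length cs = Suc k \<longrightarrow> (holds M \<theta>1 cs \<longleftrightarrow> (\<exists>as\<in>tuples (univ M) n. holds M \<theta> (as @ cs)))"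
    by blast
  obtain \<theta>' where "\<theta>' \<in> formulas L k"
    "\<And>cs. length cs = k \<Longrightarrow> holds M \<theta>' cs \<longleftrightarrow> (\<exists>a\<in>univ M. holds M \<theta>1 (a # cs))"
    using exists_first[OF \<theta>1(1), of M] by blast
  with \<theta>1(2) show ?case by (intro bexI[of _ \<theta>']) (simp_all add: ex_tuples_Suc)
qed

lemma finite_conjunction:
  fixes M :: "('f, 'r, 'm) struct"
  assumes "finite \<Delta>" "\<Delta> \<subseteq> param_formulas L A m"
  shows "\<exists>(\<phi>, bs)\<in>param_formulas L A m. \<forall>as. length as = m \<longrightarrow>
           (holds M \<phi> (as @ bs) \<longleftrightarrow> realizes M as \<Delta>)"
  using assms
proof (induction \<Delta> rule: finite_induct)
  case empty
  have "(Truth, []) \<in> param_formulas L A m" by (simp add: param_formulas_def)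
  then show ?case by (rule rev_bexI) (simp add: realizes_def)
next
  case (insert p \<Delta>)
  then obtain \<phi> bs where \<phi>: "(\<phi>, bs) \<in> param_formulas L A m"
    "\<And>as. length as = m \<Longrightarrow> holds M \<phi> (as @ bs) \<longleftrightarrow> realizes M as \<Delta>" by auto
  obtain \<psi> cs where p: "p = (\<psi>, cs)" by (cases p)
  have \<psi>: "\<psi> \<in> formulas L (m + length cs)" using insert.prems p by (auto simp: param_formulas_def)
  \<comment> \<open>The type variables are shared, while the parameters of \<open>\<psi>\<close>
    move behind \<open>bs\<close>.\<close>
  let ?g = "\<lambda>i. if i < m then i else i + length bs"
  have "inj_on ?g {..<m + length cs}"
    "\<And>i. i < m + length cs \<Longrightarrow> ?g i < m + length (bs @ cs)" by (auto simp: inj_on_def)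
  from rename_formula[OF \<psi> this, of M] obtain \<psi>' where \<psi>': "\<psi>' \<in> formulas L (m + length (bs @ cs))"
    "\<And>as bs. (\<And>i. i < m + length cs \<Longrightarrow> as ! ?g i = bs ! i) \<Longrightarrow> holds M \<psi>' as \<longleftrightarrow> holds M \<psi> bs"
    by blast
  have 1: "holds M \<psi>' (as @ bs @ cs) \<longleftrightarrow> holds M \<psi> (as @ cs)" if "length as = m" for as
    by (rule \<psi>'(2)) (use that in \<open>auto simp: nth_append\<close>)
  have 2: "holds M \<phi> (as @ bs @ cs) \<longleftrightarrow> holds M \<phi> (as @ bs)" if "length as = m" for as
    unfolding holds_def
    by (rule sat_cong) (use that \<phi>(1) in \<open>auto simp: param_formulas_def formulas_def nth_append\<close>)
  have "\<phi> \<in> formulas L (m + length (bs @ cs))"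
    using \<phi>(1) by (auto simp: param_formulas_def elim: formulas_mono)
  then have "(Conj \<phi> \<psi>', bs @ cs) \<in> param_formulas L A m"
    using \<psi>'(1) \<phi>(1) insert.prems p by (auto simp: param_formulas_def)
  then show ?case by (rule rev_bexI) (use 1 2 \<phi>(2) in \<open>auto simp: p realizes_def\<close>)
qed

text \<open>\<open>n\<close>-types are realized one coordinate at a time, the last one first, so that it can be
  prepended to the parameters of the remaining type without renaming variables.\<close>

lemma realize_type:
  fixes M :: "('f, 'r, 'm) struct"
  assumes sat1: "\<And>A \<Gamma>. A \<subseteq> univ M \<Longrightarrow> countable A \<Longrightarrow> \<Gamma> \<subseteq> param_formulas L A 1 \<Longrightarrow>
      consistent M 1 \<Gamma> \<Longrightarrow> \<exists>a\<in>univ M. realizes M [a] \<Gamma>"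
    and "A \<subseteq> univ M" "countable A" "\<Gamma> \<subseteq> param_formulas L A n" "consistent M n \<Gamma>"
  shows "\<exists>as\<in>tuples (univ M) n. realizes M as \<Gamma>"
  using assms(2-)
proof (induction n arbitrary: A \<Gamma>)
  case 0
  have "realizes M [] {p}" if "p \<in> \<Gamma>" for p
    using 0(4) that unfolding consistent_def by (metis empty_subsetI finite.emptyI finite_insert
        insert_subset singletonD tuples_0)
  then show ?case by (auto simp: realizes_def)
next
  case (Suc n)
  \<comment> \<open>The consequences of finite parts of \<open>\<Gamma>\<close> for the last
    coordinate alone. Finitely many of them follow from one finite part, the union of the parts
    used.\<close>
  define \<Gamma>1 where "\<Gamma>1 = {(\<theta>, cs). (\<theta>, cs) \<in> param_formulas L A 1 \<and>
    (\<exists>\<Delta>. finite \<Delta> \<and> \<Delta> \<subseteq> \<Gamma> \<and> (\<forall>a\<in>univ M. \<forall>as\<in>tuples (univ M) n.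
       realizes M (as @ [a]) \<Delta> \<longrightarrow> holds M \<theta> ([a] @ cs)))}"
  have "consistent M 1 \<Gamma>1"
    unfolding consistent_def
  proof (intro allI impI)
    fix \<Delta>1 assume \<Delta>1: "finite \<Delta>1 \<and> \<Delta>1 \<subseteq> \<Gamma>1"
    then have "\<forall>p\<in>\<Delta>1. \<exists>\<Delta>. finite \<Delta> \<and> \<Delta> \<subseteq> \<Gamma> \<and> (\<forall>a\<in>univ M. \<forall>as\<in>tuples (univ M) n.
       realizes M (as @ [a]) \<Delta> \<longrightarrow> holds M (fst p) ([a] @ snd p))"
      unfolding \<Gamma>1_def by force
    then obtain D where D: "\<And>p. p \<in> \<Delta>1 \<Longrightarrow> finite (D p) \<and> D p \<subseteq> \<Gamma>"
      "\<And>p a as. p \<in> \<Delta>1 \<Longrightarrow> a \<in> univ M \<Longrightarrow> as \<in> tuples (univ M) n \<Longrightarrow>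
         realizes M (as @ [a]) (D p) \<Longrightarrow> holds M (fst p) ([a] @ snd p)"
      by metis
    have "finite (\<Union>p\<in>\<Delta>1. D p) \<and> (\<Union>p\<in>\<Delta>1. D p) \<subseteq> \<Gamma>" using D(1) \<Delta>1 by blast
    then obtain xs where "xs \<in> tuples (univ M) (Suc n)" "realizes M xs (\<Union>p\<in>\<Delta>1. D p)"
      using Suc.prems(4) unfolding consistent_def by meson
    then obtain as a where a: "as \<in> tuples (univ M) n" "a \<in> univ M"
      "realizes M (as @ [a]) (\<Union>p\<in>\<Delta>1. D p)" by (auto simp: tuples_Suc)
    have "realizes M (as @ [a]) (D p)" if "p \<in> \<Delta>1" for p
      using a(3) that unfolding realizes_def by blast
    then have "realizes M [a] \<Delta>1" using D(2) a(1,2) by (force simp: realizes_def)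
    then show "\<exists>as\<in>tuples (univ M) 1. realizes M as \<Delta>1"
      using a(2) by (intro bexI[of _ "[a]"]) (auto simp: tuples_def)
  qed
  moreover have "\<Gamma>1 \<subseteq> param_formulas L A 1" by (auto simp: \<Gamma>1_def)
  ultimately obtain a where a: "a \<in> univ M" "realizes M [a] \<Gamma>1" using sat1 Suc.prems by blast
  define \<Gamma>2 where "\<Gamma>2 = (\<lambda>(\<phi>, bs). (\<phi>, a # bs)) ` \<Gamma>"
  have real2: "realizes M as ((\<lambda>(\<phi>, bs). (\<phi>, a # bs)) ` \<Delta>) \<longleftrightarrow> realizes M (as @ [a]) \<Delta>" for as \<Delta>
    by (auto simp: realizes_def)
  have "consistent M n \<Gamma>2"
    unfolding consistent_def
  proof (intro allI impI)
    fix \<Delta>2 assume "finite \<Delta>2 \<and> \<Delta>2 \<subseteq> \<Gamma>2"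
    then obtain \<Delta> where \<Delta>: "finite \<Delta>" "\<Delta> \<subseteq> \<Gamma>" "\<Delta>2 = (\<lambda>(\<phi>, bs). (\<phi>, a # bs)) ` \<Delta>"
      unfolding \<Gamma>2_def by (meson finite_subset_image)
    then have "\<Delta> \<subseteq> param_formulas L A (Suc n)" using Suc.prems(3) by blast
    from finite_conjunction[OF \<Delta>(1) this, of M] obtain \<phi> bs where
      \<phi>: "(\<phi>, bs) \<in> param_formulas L A (Suc n)"
      "\<And>xs. length xs = Suc n \<Longrightarrow> holds M \<phi> (xs @ bs) \<longleftrightarrow> realizes M xs \<Delta>" by auto
    have "\<phi> \<in> formulas L (n + (1 + length bs))" using \<phi>(1) by (simp add: param_formulas_def)
    from exists_prefix[OF this, of M] obtain \<theta> where \<theta>: "\<theta> \<in> formulas L (1 + length bs)"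
      "\<And>cs. length cs = 1 + length bs \<Longrightarrow>
         holds M \<theta> cs \<longleftrightarrow> (\<exists>as\<in>tuples (univ M) n. holds M \<phi> (as @ cs))" by blast
    have iff: "holds M \<theta> ([x] @ bs) \<longleftrightarrow> (\<exists>as\<in>tuples (univ M) n. realizes M (as @ [x]) \<Delta>)" for x
      using \<theta>(2)[of "[x] @ bs"] \<phi>(2)[of "_ @ [x]"] by (auto simp: tuples_def)
    \<comment> \<open>Every realization of \<open>\<Delta>\<close> witnesses \<open>\<theta>\<close>
      at its last coordinate, which puts \<open>\<theta>\<close> into \<open>\<Gamma>1\<close>. Its
      truth at \<open>a\<close> then supplies the other coordinates.\<close>
    have "(\<theta>, bs) \<in> \<Gamma>1"
      using \<theta>(1) \<phi>(1) \<Delta>(1,2) iff unfolding \<Gamma>1_def by (auto simp: param_formulas_def)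
    then have "holds M \<theta> ([a] @ bs)" using a(2) by (auto simp: realizes_def)
    then show "\<exists>as\<in>tuples (univ M) n. realizes M as \<Delta>2" unfolding iff \<Delta>(3) real2 .
  qed
  moreover have "\<Gamma>2 \<subseteq> param_formulas L (insert a A) n"
    using Suc.prems(3) by (fastforce simp: \<Gamma>2_def param_formulas_def)
  ultimately obtain as where "as \<in> tuples (univ M) n" "realizes M as \<Gamma>2"
    using Suc.IH[of "insert a A" \<Gamma>2] Suc.prems(1,2) a(1) by auto
  then show ?case
    using a(1) unfolding \<Gamma>2_def real2 by (intro bexI[of _ "as @ [a]"]) (auto simp: tuples_Suc)
qed

lemma monster_realizes_type:
  fixes M :: "('f, 'r, 'm) struct"
  assumes M: "monster_model L T \<kappa> M"
    and "A \<subseteq> univ M" "countable A" "\<Gamma> \<subseteq> param_formulas L A n" "consistent M n \<Gamma>"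
  shows "\<exists>as\<in>tuples (univ M) n. realizes M as \<Gamma>"
proof (rule realize_type[OF _ assms(2-)])
  fix A and \<Gamma> :: "(('f, 'r) formula \<times> 'm list) set"
  assume "A \<subseteq> univ M" "countable A" "\<Gamma> \<subseteq> param_formulas L A 1" "consistent M 1 \<Gamma>"
  moreover have "|A| <o \<kappa>"
  proof -
    have "|A| \<le>o |UNIV :: nat set|"
      using \<open>countable A\<close> unfolding countable_def by (auto intro: card_of_ordLeqI)
    moreover have "|UNIV :: nat set| \<le>o natLeq" by (rule ordIso_imp_ordLeq[OF card_of_nat])
    ultimately show ?thesis
      using M unfolding monster_model_def by (meson ordLeq_ordLess_trans ordLeq_transitive)
  qed
  ultimately show "\<exists>a\<in>univ M. realizes M [a] \<Gamma>"
    using M unfolding monster_model_def saturated_def by blast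
qed

subsection \<open>ICT patterns and interpretations\<close>

text \<open>The leading entry \<open>e\<close> does not affect truth; it is a slot that can make
  tuples distinct. In the disjuncts \<open>cs\<close> comes first, in the disjunction last.\<close>

lemma disjunction_formula:
  fixes M :: "('f, 'r, 'm) struct"
  assumes "\<And>\<alpha>. \<alpha> < d \<Longrightarrow> \<psi> \<alpha> \<in> formulas L (n + l \<alpha>)"
  shows "\<exists>\<phi>\<in>formulas L (Suc (\<Sum>\<alpha><d. l \<alpha>) + n).
     \<forall>e bs cs. length cs = n \<and> (\<forall>\<alpha><d. length (bs \<alpha>) = l \<alpha>) \<longrightarrow>
       (holds M \<phi> ((e # concat (map bs [0..<d])) @ cs) \<longleftrightarrow> (\<exists>\<alpha><d. holds M (\<psi> \<alpha>) (cs @ bs \<alpha>)))"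
  using assms
proof (induction d)
  case 0
  \<comment> \<open>The empty disjunction is false.\<close>
  show ?case by (rule bexI[of _ "Neg Truth"]) simp_all
next
  case (Suc d)
  define K where "K = Suc (\<Sum>\<alpha><d. l \<alpha>)"
  obtain \<phi> where \<phi>: "\<phi> \<in> formulas L (K + n)"
    "\<And>e bs cs. length cs = n \<Longrightarrow> \<forall>\<alpha><d. length (bs \<alpha>) = l \<alpha> \<Longrightarrow>
       holds M \<phi> ((e # concat (map bs [0..<d])) @ cs) \<longleftrightarrow> (\<exists>\<alpha><d. holds M (\<psi> \<alpha>) (cs @ bs \<alpha>))"
    using Suc unfolding K_def by (metis less_Suc_eq)
  let ?g = "\<lambda>i. if i < K then i else i + l d"
  have "inj_on ?g {..<K + n}" "\<And>i. i < K + n \<Longrightarrow> ?g i < K + l d + n" by (auto simp: inj_on_def)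
  from rename_formula[OF \<phi>(1) this, of M] obtain \<phi>' where \<phi>': "\<phi>' \<in> formulas L (K + l d + n)"
    "\<And>as bs. (\<And>i. i < K + n \<Longrightarrow> as ! ?g i = bs ! i) \<Longrightarrow> holds M \<phi>' as \<longleftrightarrow> holds M \<phi> bs" by blast
  \<comment> \<open>The variables of \<open>cs\<close> go to the end, and the \<open>l d\<close>
    variables of the new block fill the gap left by \<open>?g\<close>.\<close>
  let ?h = "\<lambda>i. if i < n then K + l d + i else K + (i - n)"
  have "\<psi> d \<in> formulas L (n + l d)" "inj_on ?h {..<n + l d}"
    "\<And>i. i < n + l d \<Longrightarrow> ?h i < K + l d + n" using Suc.prems by (auto simp: inj_on_def)
  from rename_formula[OF this, of M] obtain \<psi>' where \<psi>': "\<psi>' \<in> formulas L (K + l d + n)"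
    "\<And>as bs. (\<And>i. i < n + l d \<Longrightarrow> as ! ?h i = bs ! i) \<Longrightarrow> holds M \<psi>' as \<longleftrightarrow> holds M (\<psi> d) bs" by blast
  let ?\<chi> = "Neg (Conj (Neg \<phi>') (Neg \<psi>'))"
  show ?case
  proof (rule bexI[of _ ?\<chi>], intro allI impI)
    fix e and bs :: "nat \<Rightarrow> 'm list" and cs :: "'m list"
    assume len: "length cs = n \<and> (\<forall>\<alpha><Suc d. length (bs \<alpha>) = l \<alpha>)"
    define xs where "xs = e # concat (map bs [0..<d])"
    have "map (\<lambda>\<alpha>. length (bs \<alpha>)) [0..<d] = map l [0..<d]" using len by (intro map_cong) auto
    then have xs: "length xs = K"
      by (simp add: xs_def K_def length_concat comp_def sum_list_distinct_conv_sum_set atLeast0LessThan)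
    have "holds M \<phi>' ((xs @ bs d) @ cs) \<longleftrightarrow> holds M \<phi> (xs @ cs)"
      by (rule \<phi>'(2)) (use len xs in \<open>auto simp: nth_append\<close>)
    moreover have "holds M \<psi>' ((xs @ bs d) @ cs) \<longleftrightarrow> holds M (\<psi> d) (cs @ bs d)"
      by (rule \<psi>'(2)) (use len xs in \<open>auto simp: nth_append\<close>)
    moreover have "holds M \<phi> (xs @ cs) \<longleftrightarrow> (\<exists>\<alpha><d. holds M (\<psi> \<alpha>) (cs @ bs \<alpha>))"
      unfolding xs_def by (rule \<phi>(2)) (use len in auto)
    moreover have "e # concat (map bs [0..<Suc d]) = xs @ bs d" by (simp add: xs_def)
    ultimately show "holds M ?\<chi> ((e # concat (map bs [0..<Suc d])) @ cs) \<longleftrightarrow>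
        (\<exists>\<alpha><Suc d. holds M (\<psi> \<alpha>) (cs @ bs \<alpha>))"
      by (simp only: holds_Neg holds_Conj) (auto simp: less_Suc_eq)
  next
    show "?\<chi> \<in> formulas L (Suc (\<Sum>\<alpha><Suc d. l \<alpha>) + n)"
      using \<phi>'(1) \<psi>'(1) by (simp add: K_def)
  qed
qed

text \<open>The point \<open>m\<close> becomes the \<open>m\<close>-th column of the pattern. A
  bijection \<open>\<eta>\<close> onto a \<open>d\<close>-set selects one column per row, and the
  disjunction over the rows holds exactly at the selected columns.\<close>

lemma ict_pattern_imp_interprets:
  fixes M :: "('f, 'r, 'm) struct"
  assumes M: "monster_model L T \<kappa> M" and ict: "ict_pattern L M n {..<d} l \<psi> b"
  shows "interprets L M n (UNIV :: nat set) (nsets UNIV d)"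
proof -
  have \<psi>: "\<psi> \<alpha> \<in> formulas L (n + l \<alpha>)" and b: "b \<alpha> m \<in> tuples (univ M) (l \<alpha>)" if "\<alpha> < d" for \<alpha> m
    using ict that unfolding ict_pattern_def by auto
  obtain \<phi> where \<phi>: "\<phi> \<in> formulas L (Suc (\<Sum>\<alpha><d. l \<alpha>) + n)"
    "\<And>e bs cs. length cs = n \<Longrightarrow> \<forall>\<alpha><d. length (bs \<alpha>) = l \<alpha> \<Longrightarrow>
       holds M \<phi> ((e # concat (map bs [0..<d])) @ cs) \<longleftrightarrow> (\<exists>\<alpha><d. holds M (\<psi> \<alpha>) (cs @ bs \<alpha>))"
    using disjunction_formula[of d \<psi> L n l M] \<psi> by blast
  \<comment> \<open>Distinct first entries make \<open>f\<close> injective even if columns coincide,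
    as they do for \<open>d = 0\<close>.\<close>
  obtain e :: "nat \<Rightarrow> 'm" where e: "inj e" "range e \<subseteq> univ M"
    using M infinite_countable_subset unfolding monster_model_def by blast
  define f where "f m = e m # concat (map (\<lambda>\<alpha>. b \<alpha> m) [0..<d])" for m
  have "inj f" using e(1) by (auto simp: f_def inj_def)
  moreover have "f m \<in> tuples (univ M) (Suc (\<Sum>\<alpha><d. l \<alpha>))" for m
  proof -
    have "map (\<lambda>\<alpha>. length (b \<alpha> m)) [0..<d] = map l [0..<d]"
      using b by (intro map_cong) (auto simp: tuples_def)
    then show ?thesis
      using e(2) b by (auto simp: f_def tuples_def length_concat comp_def
          sum_list_distinct_conv_sum_set atLeast0LessThan)
  qed
  moreover have "\<exists>bs\<in>tuples (univ M) n. f ` c = {as \<in> range f. holds M \<phi> (as @ bs)}"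
    if c: "c \<in> nsets UNIV d" for c
  proof -
    from c have "finite c" "card c = d" by (auto simp: nsets_def)
    then obtain \<eta> where \<eta>: "bij_betw \<eta> {..<d} c"
      using ex_bij_betw_nat_finite[of c] by (auto simp: atLeast0LessThan)
    \<comment> \<open>Consistency gives only finite satisfiability; the parameters form a countable
      set, so the monster model realizes all of \<open>\<Gamma>\<close>.\<close>
    define \<Gamma> where "\<Gamma> = {(\<psi> \<alpha>, b \<alpha> (\<eta> \<alpha>)) | \<alpha>. \<alpha> \<in> {..<d}} \<union>
         {(Neg (\<psi> \<alpha>), b \<alpha> m) | \<alpha> m. \<alpha> \<in> {..<d} \<and> m \<noteq> \<eta> \<alpha>}"
    define A where "A = (\<Union>\<alpha>\<in>{..<d}. \<Union>m. set (b \<alpha> m))"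
    have "A \<subseteq> univ M" using b by (auto simp: A_def tuples_def)
    moreover have "countable A"
      unfolding A_def by (intro countable_UN) (auto intro: countable_finite)
    moreover have "\<Gamma> \<subseteq> param_formulas L A n"
      using \<psi> b by (auto simp: \<Gamma>_def param_formulas_def A_def tuples_def)
    moreover have "consistent M n \<Gamma>" using ict unfolding ict_pattern_def \<Gamma>_def by blast
    ultimately obtain bs where bs: "bs \<in> tuples (univ M) n" "realizes M bs \<Gamma>"
      using monster_realizes_type[OF M] by meson
    have "holds M (\<psi> \<alpha>) (bs @ b \<alpha> m) \<longleftrightarrow> m = \<eta> \<alpha>" if "\<alpha> < d" for \<alpha> m
    proof (cases "m = \<eta> \<alpha>")
      case True
      then have "(\<psi> \<alpha>, b \<alpha> m) \<in> \<Gamma>" using that by (auto simp: \<Gamma>_def)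
      then show ?thesis using bs(2) True unfolding realizes_def by auto
    next
      case False
      then have "(Neg (\<psi> \<alpha>), b \<alpha> m) \<in> \<Gamma>" using that by (auto simp: \<Gamma>_def)
      then have "\<not> holds M (\<psi> \<alpha>) (bs @ b \<alpha> m)" using bs(2) unfolding realizes_def by fastforce
      then show ?thesis using False by simp
    qed
    then have "(\<exists>\<alpha><d. holds M (\<psi> \<alpha>) (bs @ b \<alpha> m)) \<longleftrightarrow> m \<in> c" for m
      using bij_betw_imp_surj_on[OF \<eta>] by auto
    moreover have "holds M \<phi> (f m @ bs) \<longleftrightarrow> (\<exists>\<alpha><d. holds M (\<psi> \<alpha>) (bs @ b \<alpha> m))" for m
      unfolding f_def by (rule \<phi>(2)) (use bs(1) b in \<open>auto simp: tuples_def\<close>)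
    ultimately have "f ` c = {as \<in> range f. holds M \<phi> (as @ bs)}" by auto
    with bs(1) show ?thesis by blast
  qed
  ultimately show ?thesis
    unfolding interprets_def using \<phi>(1)
    by (intro exI[of _ "Suc (\<Sum>\<alpha><d. l \<alpha>)"] bexI[of _ \<phi>] exI[of _ f]) auto
qed

text \<open>Injectivity of \<open>f\<close> turns the equation between images into a pointwise
  condition on \<open>X\<close>.\<close>

lemma interpretsE:
  fixes M :: "('f, 'r, 'm) struct"
  assumes "interprets L M n X \<C>" "\<C> \<subseteq> Pow X"
  obtains k \<phi> f where "\<phi> \<in> formulas L (k + n)" "inj_on f X" "f ` X \<subseteq> tuples (univ M) k"
    "\<And>c. c \<in> \<C> \<Longrightarrow> \<exists>bs\<in>tuples (univ M) n. \<forall>x\<in>X. holds M \<phi> (f x @ bs) \<longleftrightarrow> x \<in> c"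
proof -
  obtain k \<phi> f where *: "\<phi> \<in> formulas L (k + n)" "inj_on f X" "f ` X \<subseteq> tuples (univ M) k"
    "\<forall>c\<in>\<C>. \<exists>bs\<in>tuples (univ M) n. f ` c = {as \<in> f ` X. holds M \<phi> (as @ bs)}"
    using assms(1) unfolding interprets_def by blast
  show ?thesis
  proof (rule that[OF *(1-3)])
    fix c assume c: "c \<in> \<C>"
    then obtain bs where bs: "bs \<in> tuples (univ M) n" "f ` c = {as \<in> f ` X. holds M \<phi> (as @ bs)}"
      using *(4) by blast
    have "x \<in> c \<longleftrightarrow> f x \<in> f ` c" if "x \<in> X" for x
      using inj_on_image_mem_iff[OF *(2) that, of c] c assms(2) by auto
    then show "\<exists>bs\<in>tuples (univ M) n. \<forall>x\<in>X. holds M \<phi> (f x @ bs) \<longleftrightarrow> x \<in> c"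
      using bs by (intro bexI[of _ bs]) auto
  qed
qed

text \<open>Row \<open>\<alpha>\<close> consists of the numbers congruent to \<open>\<alpha>\<close>
  modulo \<open>d\<close>. One choice per row is a \<open>d\<close>-set meeting each row exactly
  once, so the same formula serves all rows.\<close>

lemma interprets_imp_dpR_ge:
  fixes M :: "('f, 'r, 'm) struct"
  assumes "interprets L M n (UNIV :: nat set) (nsets UNIV d)"
  shows "dpR_ge L M n d"
proof -
  obtain k \<phi> and f :: "nat \<Rightarrow> 'm list" where \<phi>: "\<phi> \<in> formulas L (k + n)"
    and f: "range f \<subseteq> tuples (univ M) k"
    and c: "\<And>c. c \<in> nsets UNIV d \<Longrightarrow>
      \<exists>bs\<in>tuples (univ M) n. \<forall>j\<in>UNIV. holds M \<phi> (f j @ bs) \<longleftrightarrow> j \<in> c"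
    using interpretsE[OF assms] by (metis Pow_UNIV subset_UNIV)
  obtain \<phi>' where \<phi>': "\<phi>' \<in> formulas L (n + k)"
    "\<And>as bs. length as = k \<Longrightarrow> length bs = n \<Longrightarrow> holds M \<phi>' (bs @ as) \<longleftrightarrow> holds M \<phi> (as @ bs)"
    using swap_formula[OF \<phi>, of M] by blast
  define b where "b \<alpha> m = f (d * m + \<alpha>)" for \<alpha> m
  have "ict_pattern L M n {..<d} (\<lambda>_. k) (\<lambda>_. \<phi>') b"
    unfolding ict_pattern_def
  proof (intro conjI allI ballI)
    fix \<eta> :: "nat \<Rightarrow> nat"
    let ?c = "(\<lambda>\<alpha>. d * \<eta> \<alpha> + \<alpha>) ` {..<d}"
    have eq: "d * m + \<alpha> = d * m' + \<alpha>' \<longleftrightarrow> m = m' \<and> \<alpha> = \<alpha>'" if "\<alpha> < d" "\<alpha>' < d" for \<alpha> \<alpha>' m m'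
    proof
      assume "d * m + \<alpha> = d * m' + \<alpha>'"
      then have "(d * m + \<alpha>) div d = (d * m' + \<alpha>') div d" by simp
      then have "m = m'" using that by simp
      with \<open>d * m + \<alpha> = _\<close> show "m = m' \<and> \<alpha> = \<alpha>'" by simp
    qed simp
    have "inj_on (\<lambda>\<alpha>. d * \<eta> \<alpha> + \<alpha>) {..<d}" using eq by (auto simp: inj_on_def)
    then have "?c \<in> nsets UNIV d" by (simp add: nsets_def card_image)
    from c[OF this] obtain bs where bs: "bs \<in> tuples (univ M) n"
      "\<And>j. holds M \<phi> (f j @ bs) \<longleftrightarrow> j \<in> ?c" by blast
    have "holds M \<phi>' (bs @ b \<alpha> m) \<longleftrightarrow> m = \<eta> \<alpha>" if "\<alpha> < d" for \<alpha> m
    proof -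
      have "holds M \<phi>' (bs @ b \<alpha> m) \<longleftrightarrow> holds M \<phi> (b \<alpha> m @ bs)"
        by (rule \<phi>'(2)) (use f bs(1) in \<open>auto simp: b_def tuples_def\<close>)
      also have "\<dots> \<longleftrightarrow> d * m + \<alpha> \<in> ?c" unfolding b_def by (rule bs(2))
      also have "\<dots> \<longleftrightarrow> m = \<eta> \<alpha>" using eq[OF that] that by auto
      finally show ?thesis .
    qed
    \<comment> \<open>A single tuple realizes the whole set, hence each of its finite
      subsets.\<close>
    then have "realizes M bs ({(\<phi>', b \<alpha> (\<eta> \<alpha>)) | \<alpha>. \<alpha> \<in> {..<d}} \<union>
         {(Neg \<phi>', b \<alpha> m) | \<alpha> m. \<alpha> \<in> {..<d} \<and> m \<noteq> \<eta> \<alpha>})"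
      by (auto simp: realizes_def)
    then show "consistent M n ({(\<phi>', b \<alpha> (\<eta> \<alpha>)) | \<alpha>. \<alpha> \<in> {..<d}} \<union>
         {(Neg \<phi>', b \<alpha> m) | \<alpha> m. \<alpha> \<in> {..<d} \<and> m \<noteq> \<eta> \<alpha>})"
      unfolding consistent_def using bs(1) by (meson realizes_def subset_iff)
  qed (use \<phi>' f in \<open>auto simp: b_def\<close>)
  then show ?thesis unfolding dpR_ge_def by blast
qed

section \<open>From maximum families to \<open>d\<close>-subsets\<close>

lemma xor_formula:
  fixes M :: "('f, 'r, 'm) struct"
  assumes \<phi>: "\<phi> \<in> formulas L (k + n)"
  obtains \<chi> where "\<chi> \<in> formulas L ((k + k) + n)"
    "\<And>as as' bs. length as = k \<Longrightarrow> length as' = k \<Longrightarrow> length bs = n \<Longrightarrow>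
       holds M \<chi> ((as @ as') @ bs) \<longleftrightarrow> holds M \<phi> (as @ bs) \<noteq> holds M \<phi> (as' @ bs)"
proof -
  let ?g = "\<lambda>i. if i < k then i else k + i"
  have "inj_on ?g {..<k + n}" "\<And>i. i < k + n \<Longrightarrow> ?g i < (k + k) + n" by (auto simp: inj_on_def)
  from rename_formula[OF \<phi> this, of M] obtain \<phi>1 where \<phi>1: "\<phi>1 \<in> formulas L ((k + k) + n)"
    "\<And>as bs. (\<And>i. i < k + n \<Longrightarrow> as ! ?g i = bs ! i) \<Longrightarrow> holds M \<phi>1 as \<longleftrightarrow> holds M \<phi> bs" by blast
  \<comment> \<open>Shifting everything by \<open>k\<close> moves the objects to the second block
    and the parameters to the same place as in \<open>\<phi>1\<close>.\<close>
  have "inj_on ((+) k) {..<k + n}" "\<And>i. i < k + n \<Longrightarrow> k + i < (k + k) + n" by auto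
  from rename_formula[OF \<phi> this, of M] obtain \<phi>2 where \<phi>2: "\<phi>2 \<in> formulas L ((k + k) + n)"
    "\<And>as bs. (\<And>i. i < k + n \<Longrightarrow> as ! (k + i) = bs ! i) \<Longrightarrow> holds M \<phi>2 as \<longleftrightarrow> holds M \<phi> bs" by blast
  show ?thesis
  proof
    show "Neg (Conj (Neg (Conj \<phi>1 (Neg \<phi>2))) (Neg (Conj \<phi>2 (Neg \<phi>1)))) \<in> formulas L ((k + k) + n)"
      using \<phi>1(1) \<phi>2(1) by simp
    fix as as' bs :: "'m list" assume len: "length as = k" "length as' = k" "length bs = n"
    have "holds M \<phi>1 ((as @ as') @ bs) \<longleftrightarrow> holds M \<phi> (as @ bs)"
      by (rule \<phi>1(2)) (use len in \<open>auto simp: nth_append\<close>)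
    moreover have "holds M \<phi>2 ((as @ as') @ bs) \<longleftrightarrow> holds M \<phi> (as' @ bs)"
      by (rule \<phi>2(2)) (use len in \<open>auto simp: nth_append\<close>)
    ultimately show "holds M (Neg (Conj (Neg (Conj \<phi>1 (Neg \<phi>2))) (Neg (Conj \<phi>2 (Neg \<phi>1))))) ((as @ as') @ bs)
        \<longleftrightarrow> holds M \<phi> (as @ bs) \<noteq> holds M \<phi> (as' @ bs)"
      unfolding holds_Neg holds_Conj by blast
  qed
qed

lemma interprets_maximum_imp_interprets_nsets:
  fixes M :: "('f, 'r, 'm) struct"
  assumes M: "monster_model L T \<kappa> M"
    and X: "infinite X" and max: "d_maximum d X \<C>" and int: "interprets L M n X \<C>"
  shows "interprets L M n (UNIV :: nat set) (nsets UNIV d)"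
proof -
  have "\<C> \<subseteq> Pow X" using max by (simp add: d_maximum_def)
  then obtain k \<phi> f where \<phi>: "\<phi> \<in> formulas L (k + n)" and f: "inj_on f X" "f ` X \<subseteq> tuples (univ M) k"
    and real: "\<And>c. c \<in> \<C> \<Longrightarrow> \<exists>bs\<in>tuples (univ M) n. \<forall>x\<in>X. holds M \<phi> (f x @ bs) \<longleftrightarrow> x \<in> c"
    using interpretsE[OF int] by metis
  obtain g :: "nat \<Rightarrow> _" where g: "inj g" "range g \<subseteq> X" using infinite_countable_subset[OF X] by blast
  \<comment> \<open>Pulling back along an injective sequence in \<open>X\<close> preserves the sizes
    of traces, so the combinatorics takes place on the natural numbers.\<close>
  have card_tr: "card (trace ((\<lambda>c. g -` c) ` \<C>) A) = Phi d (card A)" if "finite A" for A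
  proof -
    have "card (trace ((\<lambda>c. g -` c) ` \<C>) A) = card ((`) g ` trace ((\<lambda>c. g -` c) ` \<C>) A)"
      by (rule card_image[symmetric]) (simp add: inj_on_def inj_image_eq_iff[OF g(1)])
    also have "(`) g ` trace ((\<lambda>c. g -` c) ` \<C>) A = trace \<C> (g ` A)"
      unfolding trace_def Setcompr_eq_image image_image by (rule image_cong) auto
    also have "card \<dots> = Phi d (card (g ` A))"
    proof -
      have "g ` A \<subseteq> X" "finite (g ` A)" using g(2) that by auto
      then show ?thesis using max by (simp add: d_maximum_def)
    qed
    also have "card (g ` A) = card A" by (rule card_image[OF inj_on_subset[OF g(1)]]) simp
    finally show ?thesis .
  qed
  obtain h \<eta> where h: "strict_mono h" and alt: "\<And>P N. finite P \<Longrightarrow> card P = d \<Longrightarrow>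
      \<exists>c\<in>(\<lambda>c. g -` c) ` \<C>. \<forall>j<N. h j \<in> c \<longleftrightarrow> j \<in> alt_word \<eta> P"
    using maximum_realizes_alt_words[OF card_tr] by blast
  define u where "u j = f (g (h j))" for j
  have gX: "g i \<in> X" for i using g(2) by blast
  have u: "u j \<in> tuples (univ M) k" for j using f(2) gX by (auto simp: u_def)
  have inj_u: "inj u"
  proof (rule injI)
    fix i j assume "u i = u j"
    then have "g (h i) = g (h j)" using inj_onD[OF f(1)] gX by (simp add: u_def)
    then show "i = j" using injD[OF g(1)] injD[OF strict_mono_imp_inj_on[OF h]] by blast
  qed
  obtain \<phi>' where \<phi>': "\<phi>' \<in> formulas L (n + k)"
    "\<And>as bs. length as = k \<Longrightarrow> length bs = n \<Longrightarrow> holds M \<phi>' (bs @ as) \<longleftrightarrow> holds M \<phi> (as @ bs)"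
    using swap_formula[OF \<phi>, of M] by blast
  have swap: "holds M \<phi>' (bs @ u j) \<longleftrightarrow> holds M \<phi> (u j @ bs)" if "bs \<in> tuples (univ M) n" for bs j
    by (rule \<phi>'(2)) (use that u in \<open>auto simp: tuples_def\<close>)
  \<comment> \<open>The family realizes each initial segment of the word separately; saturation
    yields one tuple for the entire word, which need not be a member of the family.\<close>
  have word: "\<exists>bs\<in>tuples (univ M) n. \<forall>j. holds M \<phi> (u j @ bs) \<longleftrightarrow> j \<in> alt_word \<eta> P"
    if P: "finite P" "card P = d" for P
  proof -
    let ?p = "\<lambda>j. (if j \<in> alt_word \<eta> P then \<phi>' else Neg \<phi>', u j)"
    have real_iff: "realizes M bs (?p ` J) \<longleftrightarrow> (\<forall>j\<in>J. holds M \<phi> (u j @ bs) \<longleftrightarrow> j \<in> alt_word \<eta> P)"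
      if "bs \<in> tuples (univ M) n" for bs J
      using swap[OF that] by (auto simp: realizes_def)
    have "consistent M n (range ?p)"
      unfolding consistent_def
    proof (intro allI impI)
      fix \<Delta> assume "finite \<Delta> \<and> \<Delta> \<subseteq> range ?p"
      then obtain J where J: "finite J" "\<Delta> = ?p ` J" by (meson finite_subset_image)
      obtain N where N: "J \<subseteq> {..<N}" using J(1) finite_nat_bounded by blast
      obtain c where c: "c \<in> \<C>" "\<forall>j<N. g (h j) \<in> c \<longleftrightarrow> j \<in> alt_word \<eta> P"
        using alt[OF P, of N] by auto
      obtain bs where bs: "bs \<in> tuples (univ M) n" "\<forall>x\<in>X. holds M \<phi> (f x @ bs) \<longleftrightarrow> x \<in> c"
        using real[OF c(1)] by blast
      have "\<forall>j\<in>J. holds M \<phi> (u j @ bs) \<longleftrightarrow> j \<in> alt_word \<eta> P"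
        using bs(2) c(2) N gX by (auto simp: u_def)
      then have "realizes M bs \<Delta>" unfolding J(2) real_iff[OF bs(1)] .
      with bs(1) show "\<exists>bs\<in>tuples (univ M) n. realizes M bs \<Delta>" by blast
    qed
    moreover have "range ?p \<subseteq> param_formulas L (\<Union>j. set (u j)) n"
      using \<phi>'(1) u by (auto simp: param_formulas_def tuples_def)
    moreover have "(\<Union>j. set (u j)) \<subseteq> univ M" using u by (auto simp: tuples_def)
    moreover have "countable (\<Union>j. set (u j))" by (intro countable_UN) (auto intro: countable_finite)
    ultimately obtain bs where bs: "bs \<in> tuples (univ M) n" "realizes M bs (range ?p)"
      using monster_realizes_type[OF M] by meson
    then show ?thesis using real_iff[OF bs(1), of UNIV] by auto
  qed
  obtain \<chi> where \<chi>: "\<chi> \<in> formulas L ((k + k) + n)"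
    "\<And>as as' bs. length as = k \<Longrightarrow> length as' = k \<Longrightarrow> length bs = n \<Longrightarrow>
       holds M \<chi> ((as @ as') @ bs) \<longleftrightarrow> holds M \<phi> (as @ bs) \<noteq> holds M \<phi> (as' @ bs)"
    using xor_formula[OF \<phi>, of M] by blast
  \<comment> \<open>Points become consecutive pairs, on which \<open>\<chi>\<close> detects a change
    of letter.\<close>
  define F where "F j = u (2 * j) @ u (2 * j + 1)" for j
  have len: "length (u j) = k" for j using u by (auto simp: tuples_def)
  have "inj F"
  proof (rule injI)
    fix i j assume "F i = F j"
    then have "u (2 * i) = u (2 * j)" by (simp add: F_def len)
    then show "i = j" using injD[OF inj_u] by fastforce
  qed
  moreover have "range F \<subseteq> tuples (univ M) (k + k)"
    using u by (fastforce simp: F_def tuples_def)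
  moreover have "\<exists>bs\<in>tuples (univ M) n. F ` S = {as \<in> range F. holds M \<chi> (as @ bs)}"
    if S: "S \<in> nsets UNIV d" for S
  proof -
    \<comment> \<open>The search for \<open>\<eta>\<close> advances only at the second place of each
      pair indexed by \<open>S\<close>, so \<open>alt_word_odd\<close> identifies the pairs with a
      change.\<close>
    let ?P = "(\<lambda>m. 2 * m + 1) ` S"
    have "finite ?P" "card ?P = d" using S by (auto simp: nsets_def card_image inj_on_def)
    then obtain bs where bs: "bs \<in> tuples (univ M) n"
      "\<And>j. holds M \<phi> (u j @ bs) \<longleftrightarrow> j \<in> alt_word \<eta> ?P" using word by blast
    have "holds M \<chi> (F j @ bs) \<longleftrightarrow> j \<in> S" for j
    proof -
      have "length bs = n" using bs(1) by (simp add: tuples_def)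
      then have "holds M \<chi> (F j @ bs) \<longleftrightarrow>
          holds M \<phi> (u (2 * j) @ bs) \<noteq> holds M \<phi> (u (2 * j + 1) @ bs)"
        unfolding F_def by (rule \<chi>(2)[OF len len])
      then show ?thesis unfolding bs(2) alt_word_odd .
    qed
    then have "F ` S = {as \<in> range F. holds M \<chi> (as @ bs)}" by auto
    with bs(1) show ?thesis by blast
  qed
  ultimately show ?thesis
    unfolding interprets_def using \<chi>(1)
    by (intro exI[of _ "k + k"] bexI[of _ \<chi>] exI[of _ F]) auto
qed

theorem theorem4p7:
  fixes L :: "('f, 'r) language" and T :: "('f, 'r) formula set"
    and \<kappa> :: "'k rel" and M :: "('f, 'r, 'm) struct" and n d :: nat
  assumes "complete_theory TYPE('m) L T"
    and "monster_model L T \<kappa> M"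
  shows "(interprets_infinite_maximum L M n d \<longleftrightarrow>
            interprets L M n (UNIV :: nat set) (nsets (UNIV :: nat set) d)) \<and>
         (interprets L M n (UNIV :: nat set) (nsets (UNIV :: nat set) d) \<longleftrightarrow>
            dpR_ge L M n d)"
proof (intro conjI iffI)
  assume "interprets_infinite_maximum L M n d"
  then show "interprets L M n (UNIV :: nat set) (nsets UNIV d)"
    unfolding interprets_infinite_maximum_def
    using interprets_maximum_imp_interprets_nsets[OF assms(2)] by blast
next
  assume "interprets L M n (UNIV :: nat set) (nsets UNIV d)"
  then show "interprets_infinite_maximum L M n d"
    by (rule interprets_infinite_maximumI[OF infinite_UNIV_nat d_maximum_nsets])
next
  assume "interprets L M n (UNIV :: nat set) (nsets UNIV d)"
  then show "dpR_ge L M n d" by (rule interprets_imp_dpR_ge)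
next
  assume "dpR_ge L M n d"
  then show "interprets L M n (UNIV :: nat set) (nsets UNIV d)"
    unfolding dpR_ge_def using ict_pattern_imp_interprets[OF assms(2)] by blast
qed

end
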